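(* Let $g$ be a real analytic function on $(-1,1)$ whose Taylor coefficients $(g_n)_{n\ge0}$ at $0$ are nonnegative and converge to a finite and positive limit $g_\infty$. Let $F$ be a distribution function with negative mean $\mu$ and whose tail $\overline F=1-F$ is regularly varying with index $-\alpha$ less than $-1$. Then the maximum $M$ of the associated $(g,F)$-process satisfies $$P\{M>t\}\sim\frac{(g^* )^\alpha}{-\mu\,g_\infty}\,\frac{t\,\overline F(t)}{\alpha-1}$$ as $t\to\infty$.
   Context: $(g,F)$-process: let $g(x)=\sum_{i\ge0}g_ix^i$ on $(-1,1)$ and let $(X_n)_{n\ge1}$ be independent random variables with common distribution function $F$ (with finite mean $\mu$); set $S_n=\sum_{0\le i<n}g_iX_{n-i}$ for $n\ge0$ (so $S_0=0$) and $M=\sup_{n\ge0}S_n$. The tail $\overline F$ is regularly varying with index $-\alpha$ if $\overline F(\lambda t)/\overline F(t)\to\lambda^{-\alpha}$ as $t\to\infty$ for every $\lambda>0$. $g^*=\sup_{i\ge0}g_i$. *)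

theory Defs
  imports "HOL-Probability.Probability" "HOL-Library.Landau_Symbols"
begin

(* The library's analytic_on concerns complex functions only. *)
definition real_analytic_on :: "(real \<Rightarrow> real) \<Rightarrow> real set \<Rightarrow> bool" where
  "real_analytic_on f S \<longleftrightarrow>
     (\<forall>x\<in>S. \<exists>r>0. \<exists>c :: nat \<Rightarrow> real.
        \<forall>y. \<bar>y - x\<bar> < r \<longrightarrow> (\<lambda>n. c n * (y - x) ^ n) sums f y)"

definition taylor_coeff :: "(real \<Rightarrow> real) \<Rightarrow> nat \<Rightarrow> real" where
  "taylor_coeff g n = (deriv ^^ n) g 0 / fact n"

definition distribution_function :: "(real \<Rightarrow> real) \<Rightarrow> bool" where
  "distribution_function F \<longleftrightarrow>
     mono F \<and> (\<forall>x. continuous (at_right x) F) \<and>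
     (F \<longlongrightarrow> 0) at_bot \<and> (F \<longlongrightarrow> 1) at_top"

(* Following the Bochner convention, the mean is 0 when it is not finite; finiteness is
   has_finite_mean. *)
definition has_finite_mean :: "(real \<Rightarrow> real) \<Rightarrow> bool" where
  "has_finite_mean F \<longleftrightarrow> integrable (interval_measure F) (\<lambda>x. x)"

definition mean :: "(real \<Rightarrow> real) \<Rightarrow> real" where
  "mean F = (LINT x|interval_measure F. x)"

definition tail :: "(real \<Rightarrow> real) \<Rightarrow> real \<Rightarrow> real" where
  "tail F t = 1 - F t"

definition regularly_varying :: "(real \<Rightarrow> real) \<Rightarrow> real \<Rightarrow> bool" where
  "regularly_varying f \<rho> \<longleftrightarrow>
     (\<forall>l>0. ((\<lambda>t. f (l * t) / f t) \<longlongrightarrow> l powr \<rho>) at_top)"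

(* Only the random variables X 1, X 2, ... matter; X 0 is never used. *)
definition iid_with_cdf :: "'a measure \<Rightarrow> (nat \<Rightarrow> 'a \<Rightarrow> real) \<Rightarrow> (real \<Rightarrow> real) \<Rightarrow> bool" where
  "iid_with_cdf P X F \<longleftrightarrow>
     prob_space.indep_vars P (\<lambda>_. borel) X {1..} \<and>
     (\<forall>n\<ge>1. cdf (distr P borel (X n)) = F)"

definition gF_process :: "(real \<Rightarrow> real) \<Rightarrow> (nat \<Rightarrow> 'a \<Rightarrow> real) \<Rightarrow> nat \<Rightarrow> 'a \<Rightarrow> real" where
  "gF_process g X n \<omega> = (\<Sum>i<n. taylor_coeff g i * X (n - i) \<omega>)"

(* Extended-real valued, since the supremum may be infinite on a null set. *)
definition gF_max :: "(real \<Rightarrow> real) \<Rightarrow> (nat \<Rightarrow> 'a \<Rightarrow> real) \<Rightarrow> 'a \<Rightarrow> ereal" where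
  "gF_max g X \<omega> = (SUP n. ereal (gF_process g X n \<omega>))"

end

theory Submission
  imports Defs "HOL-Real_Asymp.Real_Asymp"
begin

text \<open>The process passes a high level \<open>t\<close> because of a single big jump. Put \<open>c = - \<mu> * g_inf\<close>, so that
  \<open>S n\<close> is close to \<open>- c * n\<close>. A jump at time \<open>k\<close> is seen by the process multiplied by at most
  \<open>g\<^sup>*\<close>, a factor that is (almost) attained a bounded time later; hence it lifts the process above \<open>t\<close>
  when it exceeds about \<open>(t + c * k) / g\<^sup>*\<close>. Summing the tail over \<open>k\<close> and applying Karamata's theorem gives
  the claimed asymptotics. For the upper bound, two jumps of order \<open>t + c * k\<close> have negligible
  probability, and in the absence of jumps above \<open>\<delta> * (t + c * n)\<close> Chernoff's inequality bounds the
  deviation of \<open>S n\<close> by an arbitrarily high negative power of \<open>t + c * n\<close>, which is small enough to be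
  summed over \<open>n\<close>. For the lower bound, Bonferroni's inequality and a weak law of large numbers suffice.\<close>

section \<open>Regularly varying tails\<close>

text \<open>Moments: \<alpha> may lie below 2 and the left tail has no more than a mean, so
  \<open>X n\<close> itself cannot be squared. Exponential moments are therefore taken after a
  truncation from above only, and the weak law is derived in mean, with a two-sided truncation.
  Weights: they need not be monotone and \<open>S n\<close> has no independent increments, so the
  estimates rest on \<open>0 \<le> w i \<le> G\<close> and on the linear growth of the partial sums
  of \<open>w\<close>. Uniformity in \<open>n\<close>: the thresholds of jumps are attached to the
  jump time \<open>k\<close>, not to the time \<open>n\<close> at which the level is passed, so that
  each jump is counted once. Only the estimate without jumps is summed over all \<open>n\<close>,
  and over the \<open>n\<close> positions of the one exempted index. This dictates the degree
  \<alpha> + 4: one power pays for these positions, two make the series converge, and the remaining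
  \<alpha> + 1 beat \<open>t * f t\<close>. Such a power of \<open>t + c * n\<close> is what the
  logarithm in Chernoff's parameter buys. Loss: \<open>G\<close> may be approached by the weights
  without being attained, so the lower bound uses a fixed lag whose weight is nearly
  \<open>G\<close>.\<close>

lemma set_integrable_powr_to_inf:
  fixes \<alpha> :: real
  assumes "1 < \<alpha>"
  shows "set_integrable lborel {1..} (\<lambda>s::real. s powr - \<alpha>)"
    and "(LINT s:{1..}|lborel. s powr - \<alpha>) = 1 / (\<alpha> - 1)"
proof -
  have hi: "((\<lambda>s::real. s powr - \<alpha>) has_integral 1 / (\<alpha> - 1)) {1..}"
  proof -
    have "- (1 powr (- \<alpha> + 1)) / (- \<alpha> + 1) = 1 / (\<alpha> - 1)"
      using assms by (simp add: divide_simps)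
    then show ?thesis
      using has_integral_powr_to_inf[of "- \<alpha>" 1] assms by simp
  qed
  then have "(\<lambda>s::real. s powr - \<alpha>) absolutely_integrable_on {1..}"
    by (intro nonnegative_absolutely_integrable_1) auto
  then show *: "set_integrable lborel {1..} (\<lambda>s::real. s powr - \<alpha>)"
    unfolding set_integrable_def by (subst (asm) integrable_completion) auto
  show "(LINT s:{1..}|lborel. s powr - \<alpha>) = 1 / (\<alpha> - 1)"
    using set_borel_integral_eq_integral(2)[OF *] hi by (simp add: integral_unique)
qed

locale rv_tail =
  fixes f :: "real \<Rightarrow> real" and \<alpha> :: real
  assumes f_antimono: "x \<le> y \<Longrightarrow> f y \<le> f x"
    and f_nonneg: "0 \<le> f x"
    and f_rv: "regularly_varying f (- \<alpha>)"
    and \<alpha>_gt_1: "1 < \<alpha>"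
begin

lemma f_ratio_tendsto: "l > 0 \<Longrightarrow> ((\<lambda>t. f (l * t) / f t) \<longlongrightarrow> l powr - \<alpha>) at_top"
  using f_rv by (auto simp: regularly_varying_def)

text \<open>Regular variation at \<open>l = 1\<close> forces this: beyond a zero of the decreasing
  \<open>f\<close> every quotient would be \<open>0 / 0\<close>, which is 0 by convention, whereas
  the limit has to be 1.\<close>

lemma f_pos: "0 < f x"
proof (rule ccontr)
  assume "\<not> 0 < f x"
  then have "f t = 0" if "t \<ge> x" for t
    using f_antimono[OF that] f_nonneg[of t] by linarith
  then have "eventually (\<lambda>t. f (1 * t) / f t = 0) at_top"
    by (auto simp: eventually_at_top_linorder intro!: exI[of _ x])
  then have "((\<lambda>t. f (1 * t) / f t) \<longlongrightarrow> 0) at_top"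
    by (rule tendsto_eventually)
  moreover have "((\<lambda>t. f (1 * t) / f t) \<longlongrightarrow> 1 powr - \<alpha>) at_top"
    by (rule f_ratio_tendsto) simp
  ultimately show False
    using tendsto_unique by force
qed

lemma f_measurable [measurable]: "f \<in> borel_measurable borel"
proof -
  have "mono (\<lambda>x. - f x)" by (auto intro!: monoI f_antimono)
  then have "(\<lambda>x. - f x) \<in> borel_measurable borel" by (rule borel_measurable_mono)
  then show ?thesis by simp
qed

section \<open>Potter bounds\<close>

lemma potter_upper:
  assumes "0 < \<beta>" "\<beta> < \<alpha>"
  obtains x0 C where "x0 > 0" "C > 0"
    "\<And>x s. x \<ge> x0 \<Longrightarrow> s \<ge> 1 \<Longrightarrow> f (s * x) \<le> C * s powr - \<beta> * f x"
proof -
  \<comment> \<open>The limit \<open>2 powr - \<alpha>\<close> lies strictly below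
    \<open>2 powr - \<beta>\<close>, so each doubling of a large argument gains the factor
    \<open>2 powr - \<beta>\<close>. Iteration handles powers of 2; monotonicity handles the points
    in between, at the price of the constant \<open>2 powr \<beta>\<close>.\<close>
  have "eventually (\<lambda>t. f (2 * t) / f t < 2 powr - \<beta>) at_top"
    using f_ratio_tendsto[of 2] assms by (intro order_tendstoD) auto
  then have "eventually (\<lambda>t. f (2 * t) / f t < 2 powr - \<beta> \<and> t > 0) at_top"
    by (intro eventually_conj eventually_gt_at_top)
  then obtain x0 where "\<And>x. x \<ge> x0 \<Longrightarrow> f (2 * x) / f x < 2 powr - \<beta> \<and> x > 0"
    unfolding eventually_at_top_linorder by blast
  then have x0: "x0 > 0" and step: "\<And>x. x \<ge> x0 \<Longrightarrow> f (2 * x) \<le> 2 powr - \<beta> * f x"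
    using f_pos by (auto simp: field_simps less_imp_le)
  have iter: "f (2 ^ m * x) \<le> 2 powr (- \<beta> * m) * f x" if "x \<ge> x0" for m x
  proof (induction m)
    case (Suc m)
    have "1 * x \<le> 2 ^ m * x" using that x0 by (intro mult_right_mono) auto
    then have "f (2 ^ Suc m * x) \<le> 2 powr - \<beta> * f (2 ^ m * x)"
      using step[of "2 ^ m * x"] that by (simp add: mult.assoc)
    also have "\<dots> \<le> 2 powr - \<beta> * (2 powr (- \<beta> * m) * f x)"
      by (intro mult_left_mono Suc) auto
    also have "\<dots> = 2 powr (- \<beta> * Suc m) * f x"
      by (simp add: powr_add [symmetric] algebra_simps)
    finally show ?case .
  qed simp
  have "f (s * x) \<le> 2 powr \<beta> * s powr - \<beta> * f x" if "x \<ge> x0" "s \<ge> 1" for x s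
  proof -
    define m where "m = nat \<lfloor>log 2 s\<rfloor>"
    have m: "real m \<le> log 2 s" "log 2 s < real m + 1"
      using that by (auto simp: m_def)
    have "2 ^ m = 2 powr real m" by (simp add: powr_realpow)
    also have "\<dots> \<le> 2 powr log 2 s" using m by simp
    also have "\<dots> = s" using that by simp
    finally have "f (s * x) \<le> f (2 ^ m * x)"
      using that x0 by (intro f_antimono mult_right_mono) auto
    also have "\<dots> \<le> 2 powr (- \<beta> * m) * f x" by (rule iter) fact
    also have "\<dots> \<le> 2 powr (- \<beta> * (log 2 s - 1)) * f x"
      using m assms f_nonneg[of x] by (intro mult_right_mono) (auto intro!: mult_left_mono)
    also have "2 powr (- \<beta> * (log 2 s - 1)) = 2 powr \<beta> * s powr - \<beta>"
    proof -
      have "2 powr (- \<beta> * (log 2 s - 1)) = 2 powr \<beta> * (2 powr log 2 s) powr - \<beta>"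
        by (simp add: powr_powr powr_add [symmetric] algebra_simps)
      then show ?thesis using that by simp
    qed
    finally show ?thesis .
  qed
  then show thesis using x0 that[of x0 "2 powr \<beta>"] by simp
qed

text \<open>Serves to compare pure powers of \<open>t\<close> with \<open>t * f t\<close>; for this
  a fixed base point \<open>x0\<close> is enough.\<close>

lemma potter_lower:
  assumes "\<alpha> < \<gamma>"
  obtains x0 C where "x0 > 0" "C > 0" "\<And>x. x \<ge> x0 \<Longrightarrow> C * x powr - \<gamma> \<le> f x"
proof -
  have "eventually (\<lambda>t. f (2 * t) / f t > 2 powr - \<gamma>) at_top"
    using f_ratio_tendsto[of 2] assms by (intro order_tendstoD) auto
  then have "eventually (\<lambda>t. f (2 * t) / f t > 2 powr - \<gamma> \<and> t > 0) at_top"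
    by (intro eventually_conj eventually_gt_at_top)
  then obtain x0 where "\<And>x. x \<ge> x0 \<Longrightarrow> f (2 * x) / f x > 2 powr - \<gamma> \<and> x > 0"
    unfolding eventually_at_top_linorder by blast
  then have x0: "x0 > 0" and step: "\<And>x. x \<ge> x0 \<Longrightarrow> f (2 * x) \<ge> 2 powr - \<gamma> * f x"
    using f_pos by (auto simp: field_simps less_imp_le)
  have iter: "f (2 ^ m * x0) \<ge> 2 powr (- \<gamma> * m) * f x0" for m
  proof (induction m)
    case (Suc m)
    have "1 * x0 \<le> 2 ^ m * x0" using x0 by (intro mult_right_mono) auto
    then have "f (2 ^ Suc m * x0) \<ge> 2 powr - \<gamma> * f (2 ^ m * x0)"
      using step[of "2 ^ m * x0"] by (simp add: mult.assoc)
    moreover have "2 powr - \<gamma> * f (2 ^ m * x0) \<ge> 2 powr - \<gamma> * (2 powr (- \<gamma> * m) * f x0)"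
      by (intro mult_left_mono Suc) auto
    moreover have "2 powr - \<gamma> * (2 powr (- \<gamma> * m) * f x0) = 2 powr (- \<gamma> * Suc m) * f x0"
      by (simp add: powr_add [symmetric] algebra_simps)
    ultimately show ?case by linarith
  qed simp
  have "2 powr - \<gamma> * x0 powr \<gamma> * f x0 * x powr - \<gamma> \<le> f x" if "x \<ge> x0" for x
  proof -
    \<comment> \<open>Rounded up here, down in the upper bound: monotonicity bounds
      \<open>f x\<close> from below by a value taken to the right of \<open>x\<close>.\<close>
    define m where "m = nat \<lceil>log 2 (x / x0)\<rceil>"
    have m: "real m \<ge> log 2 (x / x0)" "real m \<le> log 2 (x / x0) + 1"
      using that x0 by (auto simp: m_def)
    have "x / x0 = 2 powr log 2 (x / x0)" using that x0 by simp
    also have "\<dots> \<le> 2 powr real m" using m by simp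
    also have "\<dots> = 2 ^ m" by (simp add: powr_realpow)
    finally have "x \<le> 2 ^ m * x0" using x0 by (simp add: field_simps)
    then have "f (2 ^ m * x0) \<le> f x" by (rule f_antimono)
    moreover have "2 powr (- \<gamma> * (log 2 (x / x0) + 1)) * f x0 \<le> 2 powr (- \<gamma> * m) * f x0"
      using m assms \<alpha>_gt_1 f_nonneg[of x0] by (intro mult_right_mono) (auto intro!: mult_left_mono)
    moreover have "2 powr (- \<gamma> * (log 2 (x / x0) + 1)) = 2 powr - \<gamma> * x0 powr \<gamma> * x powr - \<gamma>"
    proof -
      have "2 powr (- \<gamma> * (log 2 (x / x0) + 1)) = 2 powr - \<gamma> * (2 powr log 2 (x / x0)) powr - \<gamma>"
        by (simp add: powr_powr powr_add [symmetric] algebra_simps)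
      then show ?thesis using that x0 by (simp add: powr_divide powr_minus divide_simps)
    qed
    ultimately show ?thesis using iter[of m] by (simp add: mult_ac)
  qed
  then show thesis using x0 f_pos[of x0] that[of x0 "2 powr - \<gamma> * x0 powr \<gamma> * f x0"] by simp
qed


section \<open>Karamata's theorem and sums of the tail along a line\<close>

lemma karamata:
  obtains x0 where "x0 > 0" "\<And>x. x \<ge> x0 \<Longrightarrow> set_integrable lborel {x..} f"
    and "((\<lambda>x. (LINT u:{x..}|lborel. f u) / (x * f x)) \<longlongrightarrow> 1 / (\<alpha> - 1)) at_top"
proof -
  \<comment> \<open>Any exponent strictly between 1 and \<alpha> would do: below \<alpha> for
    Potter's bound, above 1 for an integrable majorant.\<close>
  define \<beta> where "\<beta> = (1 + \<alpha>) / 2"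
  have \<beta>: "1 < \<beta>" "\<beta> < \<alpha>" using \<alpha>_gt_1 by (auto simp: \<beta>_def)
  obtain x0 C where x0: "x0 > 0" "C > 0"
    and potter: "\<And>x s. x \<ge> x0 \<Longrightarrow> s \<ge> 1 \<Longrightarrow> f (s * x) \<le> C * s powr - \<beta> * f x"
    using potter_upper[of \<beta>] \<beta> by auto
  \<comment> \<open>The substitution \<open>u = x * s\<close> turns the integral over
    \<open>{x..}\<close>, divided by \<open>x * f x\<close>, into the integral of
    \<open>q x\<close>. Pointwise, \<open>q x\<close> tends to \<open>s powr - \<alpha>\<close> on
    \<open>{1..}\<close>, and Potter's bound supplies the majorant \<open>w\<close>.\<close>
  define q where "q x s = indicator {1..} s * (f (s * x) / f x)" for x s :: real
  define w where "w s = C * (indicator {1..} s * s powr - \<beta>)" for s :: real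
  have int_w: "integrable lborel w"
    using set_integrable_powr_to_inf(1)[OF \<beta>(1)] unfolding w_def set_integrable_def by auto
  have bound: "norm (q x s) \<le> w s" if "x \<ge> x0" for x s
    using potter[OF that, of s] f_pos[of x] f_nonneg[of "s * x"]
    by (auto simp: q_def w_def indicator_def field_simps)
  have q_meas: "q x \<in> borel_measurable lborel" for x
    unfolding q_def by measurable
  have int_q: "integrable lborel (q x)" if "x \<ge> x0" for x
    by (rule Bochner_Integration.integrable_bound[OF int_w q_meas])
       (use bound[OF that] in \<open>auto intro!: AE_I2 order_trans[OF _ abs_ge_self]\<close>)
  have lim: "((\<lambda>x. integral\<^sup>L lborel (q x)) \<longlongrightarrow>
      integral\<^sup>L lborel (\<lambda>s. indicator {1..} s * s powr - \<alpha>)) at_top"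
  proof (rule integral_dominated_convergence_at_top[where w = w])
    show "AE s in lborel. ((\<lambda>x. q x s) \<longlongrightarrow> indicator {1..} s * s powr - \<alpha>) at_top"
    proof (rule AE_I2)
      fix s :: real
      show "((\<lambda>x. q x s) \<longlongrightarrow> indicator {1..} s * s powr - \<alpha>) at_top"
        unfolding q_def by (cases "s \<ge> 1") (auto intro!: f_ratio_tendsto)
    qed
    show "\<forall>\<^sub>F x in at_top. AE s in lborel. norm (q x s) \<le> w s"
      using eventually_ge_at_top[of x0] by eventually_elim (auto intro!: AE_I2 bound[simplified])
  qed (use q_meas int_w in auto)
  \<comment> \<open>The form \<open>0 + x * s\<close> is that of the affine change of variables for
    Lebesgue measure, with shift 0.\<close>
  have eq: "indicator {x..} (0 + x * s) *\<^sub>R f (0 + x * s) = f x * q x s" if "x \<ge> x0" for x s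
    using that x0 f_pos[of x] by (auto simp: q_def indicator_def mult.commute)
  have si: "set_integrable lborel {x..} f" if "x \<ge> x0" for x
  proof -
    have "integrable lborel (\<lambda>s. indicator {x..} (0 + x * s) *\<^sub>R f (0 + x * s))"
      unfolding eq[OF that] using int_q[OF that] by auto
    then show ?thesis
      unfolding set_integrable_def
      using lborel_integrable_real_affine_iff[of x "\<lambda>u. indicator {x..} u *\<^sub>R f u" 0] that x0 by auto
  qed
  have "(LINT u:{x..}|lborel. f u) = x * f x * integral\<^sup>L lborel (q x)" if "x \<ge> x0" for x
    unfolding set_lebesgue_integral_def
    by (subst lborel_integral_real_affine[of x _ 0]) (use that x0 in \<open>simp_all add: eq[OF that, simplified]\<close>)
  then have "\<forall>\<^sub>F x in at_top. integral\<^sup>L lborel (q x) = (LINT u:{x..}|lborel. f u) / (x * f x)"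
    unfolding eventually_at_top_linorder using x0 f_pos
    by (intro exI[of _ x0]) (auto simp: less_imp_neq[OF f_pos, symmetric])
  from Lim_transform_eventually[OF lim this]
  have "((\<lambda>x. (LINT u:{x..}|lborel. f u) / (x * f x)) \<longlongrightarrow> 1 / (\<alpha> - 1)) at_top"
    using set_integrable_powr_to_inf(2)[OF \<alpha>_gt_1] by (simp add: set_lebesgue_integral_def)
  with x0 si that show thesis by blast
qed

text \<open>Comparison of sum and integral on cells of length \<open>c * r\<close>: by monotonicity
  the integral over a cell lies between the values at its two endpoints. The sums over left and
  right endpoints differ by the first term \<open>f (r * t)\<close> alone.\<close>

lemma tail_sum_bounds:
  assumes int: "set_integrable lborel {r * t..} f" and "r > 0" "c > 0"
  shows "summable (\<lambda>k. f (r * (t + c * real (Suc k))))"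
    and "c * r * (\<Sum>k. f (r * (t + c * real (Suc k)))) \<le> (LINT u:{r * t..}|lborel. f u)"
    and "(LINT u:{r * t..}|lborel. f u) \<le> c * r * (f (r * t) + (\<Sum>k. f (r * (t + c * real (Suc k)))))"
proof -
  define p where "p k = r * (t + c * real k)" for k
  define I where "I k = {p k..<p (Suc k)}" for k
  have p_mono: "p i \<le> p j" if "i \<le> j" for i j
    using that assms by (auto simp: p_def intro!: mult_left_mono)
  have p_Suc: "p (Suc k) = p k + c * r" for k by (simp add: p_def algebra_simps)
  have disj: "disjoint_family I"
  unfolding disjoint_family_on_def
  proof (intro ballI impI)
    fix m n :: nat assume "m \<noteq> n"
    then show "I m \<inter> I n = {}"
      using p_mono[of "Suc m" n] p_mono[of "Suc n" m] unfolding I_def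
      by (cases "m < n") (force simp: Suc_le_eq not_less)+
  qed
  have un: "(\<Union>k. I k) = {r * t..}"
  proof safe
    fix x k assume "x \<in> I k"
    then show "r * t \<le> x" using p_mono[of 0 k] by (auto simp: I_def p_def)
  next
    fix x assume x: "r * t \<le> x"
    define k where "k = nat \<lfloor>(x - r * t) / (r * c)\<rfloor>"
    have "real k \<le> (x - r * t) / (r * c)" "(x - r * t) / (r * c) < real k + 1"
      using x assms by (auto simp: k_def)
    then have "x \<in> I k" using assms by (auto simp: I_def p_def field_simps)
    then show "x \<in> (\<Union>k. I k)" by blast
  qed
  have int_I: "set_integrable lborel (I k) f" for k
    by (rule set_integrable_subset[OF int]) (auto simp: un [symmetric], auto simp: I_def)
  have "summable (\<lambda>k. LINT u:I k|lborel. f u)"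
  proof (rule summableI_nonneg_bounded)
    show "0 \<le> (LINT u:I k|lborel. f u)" for k
      unfolding set_lebesgue_integral_def by (intro integral_nonneg_AE) (auto simp: f_nonneg)
    show "(\<Sum>k<n. LINT u:I k|lborel. f u) \<le> (LINT u:{r * t..}|lborel. f u)" for n
    proof -
      have "(\<Sum>k<n. LINT u:I k|lborel. f u) = (LINT u:(\<Union>k<n. I k)|lborel. f u)"
        using disj int_I
        by (subst set_integral_finite_Union) (auto simp: disjoint_family_on_def I_def)
      also have "\<dots> \<le> (LINT u:{r * t..}|lborel. f u)"
        using int set_integrable_UN[of "{..<n}" lborel I f] int_I
        unfolding set_lebesgue_integral_def set_integrable_def un [symmetric]
        by (intro integral_mono) (auto simp: I_def f_nonneg split: split_indicator)
      finally show ?thesis .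
    qed
  qed
  moreover have "(LINT u:(\<Union>k. I k)|lborel. f u) = (\<Sum>k. LINT u:I k|lborel. f u)"
    by (rule lebesgue_integral_countable_add)
       (use disj int in \<open>auto simp: un disjoint_family_on_def, auto simp: I_def\<close>)
  ultimately have sums: "(\<lambda>k. LINT u:I k|lborel. f u) sums (LINT u:{r * t..}|lborel. f u)"
    by (simp add: un sums_iff)
  have const: "(LINT u:I k|lborel. a) = c * r * a" "set_integrable lborel (I k) (\<lambda>_. a)" for k and a :: real
    using assms by (auto simp: I_def p_Suc set_lebesgue_integral_def set_integrable_def)
  have lower: "c * r * f (p (Suc k)) \<le> (LINT u:I k|lborel. f u)" for k
    unfolding const(1)[of k, symmetric]
    by (rule set_integral_mono[OF const(2) int_I]) (auto simp: I_def intro!: f_antimono)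
  have upper: "(LINT u:I k|lborel. f u) \<le> c * r * f (p k)" for k
    unfolding const(1)[of k, symmetric]
    by (rule set_integral_mono[OF int_I const(2)]) (auto simp: I_def intro!: f_antimono)
  have summ: "summable (\<lambda>k. c * r * f (p (Suc k)))"
    by (rule summable_comparison_test'[OF sums_summable[OF sums], of 0])
       (use lower assms f_nonneg in auto)
  then have summ': "summable (\<lambda>k. f (p (Suc k)))"
    using summable_mult[OF summ, of "1 / (c * r)"] assms by simp
  then show "summable (\<lambda>k. f (r * (t + c * real (Suc k))))" by (simp add: p_def)
  have "c * r * (\<Sum>k. f (p (Suc k))) = (\<Sum>k. c * r * f (p (Suc k)))"
    by (rule suminf_mult[OF summ', symmetric])
  also have "\<dots> \<le> (LINT u:{r * t..}|lborel. f u)"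
    using suminf_le[OF lower summ sums_summable[OF sums]] sums_unique[OF sums] by simp
  finally show "c * r * (\<Sum>k. f (r * (t + c * real (Suc k)))) \<le> (LINT u:{r * t..}|lborel. f u)"
    by (simp add: p_def)
  have summ0: "summable (\<lambda>k. f (p k))" using summ' by (subst (asm) summable_Suc_iff)
  have "(LINT u:{r * t..}|lborel. f u) = (\<Sum>k. LINT u:I k|lborel. f u)"
    by (rule sums_unique[OF sums])
  also have "\<dots> \<le> (\<Sum>k. c * r * f (p k))"
    by (rule suminf_le[OF upper sums_summable[OF sums] summable_mult[OF summ0]])
  also have "\<dots> = c * r * (f (p 0) + (\<Sum>k. f (p (Suc k))))"
    using suminf_mult[OF summ0] suminf_split_head[OF summ0] by simp
  finally show "(LINT u:{r * t..}|lborel. f u) \<le> c * r * (f (r * t) + (\<Sum>k. f (r * (t + c * real (Suc k)))))"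
    by (simp add: p_def)
qed

text \<open>For variables with tail \<open>f\<close> this is the expected number of times
  \<open>k \<ge> 1\<close> with a jump above \<open>r * (t + c * k)\<close>; the successor excludes
  time 0. Both bounds on the maximum are expressed through it.\<close>

definition tail_sum :: "real \<Rightarrow> real \<Rightarrow> real \<Rightarrow> real" where
  "tail_sum r c t = (\<Sum>k. f (r * (t + c * real (Suc k))))"

lemma tail_sum_summable:
  assumes "r > 0" "c > 0"
  shows "eventually (\<lambda>t. summable (\<lambda>k. f (r * (t + c * real (Suc k))))) at_top"
proof -
  obtain x0 where x0: "x0 > 0" "\<And>x. x \<ge> x0 \<Longrightarrow> set_integrable lborel {x..} f"
    using karamata by metis
  show ?thesis
    using eventually_ge_at_top[of "x0 / r"]
    by eventually_elim (rule tail_sum_bounds(1), auto intro!: x0 assms simp: assms field_simps)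
qed

text \<open>Karamata's theorem gives the integral from \<open>r * t\<close> on, regular variation
  replaces \<open>f (r * t)\<close> by \<open>r powr - \<alpha> * f t\<close>, and the mesh
  \<open>c * r\<close> is divided out. The discrepancy between sum and integral is of order
  \<open>f t\<close>, hence negligible against \<open>t * f t\<close>.\<close>

lemma tail_sum_asymp:
  assumes r: "r > 0" and c: "c > 0"
  shows "((\<lambda>t. tail_sum r c t / (t * f t)) \<longlongrightarrow> r powr - \<alpha> / (c * (\<alpha> - 1))) at_top"
proof -
  obtain x0 where x0: "x0 > 0" "\<And>x. x \<ge> x0 \<Longrightarrow> set_integrable lborel {x..} f"
    and kar: "((\<lambda>x. (LINT u:{x..}|lborel. f u) / (x * f x)) \<longlongrightarrow> 1 / (\<alpha> - 1)) at_top"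
    using karamata by metis
  define J where "J x = (LINT u:{x..}|lborel. f u)" for x
  have rt: "filterlim (\<lambda>t. r * t) at_top at_top"
    using r by (intro filterlim_tendsto_pos_mult_at_top[OF tendsto_const]) (auto simp: filterlim_ident)
  have "((\<lambda>t. J (r * t) / (r * t * f (r * t)) * (f (r * t) / f t) / c) \<longlongrightarrow>
      1 / (\<alpha> - 1) * r powr - \<alpha> / c) at_top"
    using tendsto_divide[OF tendsto_mult[OF filterlim_compose[OF kar rt] f_ratio_tendsto[OF r]]
        tendsto_const[of c]] c
    by (simp add: J_def)
  moreover have "J (r * t) / (r * t * f (r * t)) * (f (r * t) / f t) / c = J (r * t) / (c * r) / (t * f t)" for t
    using f_pos[of "r * t"] by (simp add: field_simps)
  ultimately have up: "((\<lambda>t. J (r * t) / (c * r) / (t * f t)) \<longlongrightarrow> r powr - \<alpha> / (c * (\<alpha> - 1))) at_top"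
    by (simp add: field_simps)
  have "((\<lambda>t. J (r * t) / (c * r) / (t * f t) - (f (r * t) / f t) * inverse t) \<longlongrightarrow>
     r powr - \<alpha> / (c * (\<alpha> - 1)) - r powr - \<alpha> * 0) at_top"
    using r by (intro tendsto_diff up tendsto_mult f_ratio_tendsto tendsto_inverse_0_at_top filterlim_ident)
  then have lo: "((\<lambda>t. J (r * t) / (c * r) / (t * f t) - (f (r * t) / f t) * inverse t) \<longlongrightarrow>
     r powr - \<alpha> / (c * (\<alpha> - 1))) at_top" by simp
  have ev: "eventually (\<lambda>t. t \<ge> x0 / r \<and> t > 0) at_top"
    by (intro eventually_conj eventually_ge_at_top eventually_gt_at_top)
  show ?thesis
  proof (rule tendsto_sandwich[OF _ _ lo up])
    show "\<forall>\<^sub>F t in at_top. J (r * t) / (c * r) / (t * f t) - f (r * t) / f t * inverse t \<le> tail_sum r c t / (t * f t)"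
      using ev
    proof eventually_elim
      case (elim t)
      then have int: "set_integrable lborel {r * t..} f" using r by (intro x0) (auto simp: field_simps)
      have "J (r * t) / (c * r) \<le> f (r * t) + tail_sum r c t"
        using tail_sum_bounds(3)[OF int r c] r c by (simp add: J_def tail_sum_def field_simps)
      then have "J (r * t) / (c * r) / (t * f t) \<le> (f (r * t) + tail_sum r c t) / (t * f t)"
        using elim f_nonneg[of t] by (intro divide_right_mono) auto
      then show ?case by (simp add: add_divide_distrib divide_inverse algebra_simps)
    qed
    show "\<forall>\<^sub>F t in at_top. tail_sum r c t / (t * f t) \<le> J (r * t) / (c * r) / (t * f t)"
      using ev
    proof eventually_elim
      case (elim t)
      then have int: "set_integrable lborel {r * t..} f" using r by (intro x0) (auto simp: field_simps)
      have "tail_sum r c t \<le> J (r * t) / (c * r)"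
        using tail_sum_bounds(2)[OF int r c] r c by (simp add: J_def tail_sum_def field_simps)
      then show ?case
        using elim f_nonneg[of t] by (intro divide_right_mono) auto
    qed
  qed
qed

text \<open>A Potter exponent \<beta> above 1 yields the order \<open>t powr (1 - \<beta>)\<close>.
  This is why pairs of jumps, whose probability is of order \<open>(t * f t)\<^sup>2\<close>, do not
  count.\<close>

lemma mult_f_tendsto_0: "((\<lambda>t. t * f t) \<longlongrightarrow> 0) at_top"
proof -
  define \<beta> where "\<beta> = (1 + \<alpha>) / 2"
  have \<beta>: "1 < \<beta>" "\<beta> < \<alpha>" using \<alpha>_gt_1 by (auto simp: \<beta>_def)
  obtain x0 C where x0: "x0 > 0" "C > 0"
    and potter: "\<And>x s. x \<ge> x0 \<Longrightarrow> s \<ge> 1 \<Longrightarrow> f (s * x) \<le> C * s powr - \<beta> * f x"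
    using potter_upper[of \<beta>] \<beta> by auto
  have "((\<lambda>t. C * x0 powr \<beta> * f x0 * t powr (1 - \<beta>)) \<longlongrightarrow> C * x0 powr \<beta> * f x0 * 0) at_top"
    using \<beta> by (intro tendsto_mult tendsto_const tendsto_neg_powr filterlim_ident) auto
  then have lim: "((\<lambda>t. C * x0 powr \<beta> * f x0 * t powr (1 - \<beta>)) \<longlongrightarrow> 0) at_top" by simp
  show ?thesis
  proof (rule tendsto_sandwich[OF _ _ tendsto_const lim])
    show "\<forall>\<^sub>F t in at_top. 0 \<le> t * f t"
      using eventually_ge_at_top[of 0] by eventually_elim (simp add: f_nonneg)
    show "\<forall>\<^sub>F t in at_top. t * f t \<le> C * x0 powr \<beta> * f x0 * t powr (1 - \<beta>)"
      using eventually_ge_at_top[of x0]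
    proof eventually_elim
      case (elim t)
      have "f (t / x0 * x0) \<le> C * (t / x0) powr - \<beta> * f x0"
        using elim x0 by (intro potter) auto
      then have "f t \<le> C * x0 powr \<beta> * f x0 * t powr - \<beta>"
        using x0 elim by (simp add: powr_divide powr_minus divide_simps mult_ac)
      then have "t * f t \<le> t * (C * x0 powr \<beta> * f x0 * t powr - \<beta>)"
        using x0 elim by (intro mult_left_mono) auto
      also have "\<dots> = C * x0 powr \<beta> * f x0 * t powr (1 - \<beta>)"
        using x0 elim by (simp add: powr_diff powr_minus divide_inverse)
      finally show ?case .
    qed
  qed
qed

text \<open>Potter's lower bound with the exponent \<alpha> + 1 leaves a quotient of at most
  \<open>1 / (C * t)\<close>. The power is the one that remains as error term in the upper
  bound.\<close>

lemma powr_negligible: "((\<lambda>t. t powr - (\<alpha> + 1) / (t * f t)) \<longlongrightarrow> 0) at_top"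
proof -
  obtain x0 C where x0: "x0 > 0" "C > 0" and lower: "\<And>x. x \<ge> x0 \<Longrightarrow> C * x powr - (\<alpha> + 1) \<le> f x"
    using potter_lower[of "\<alpha> + 1"] by auto
  have lim: "((\<lambda>t. 1 / (C * t)) \<longlongrightarrow> 0) at_top" using x0 by real_asymp
  show ?thesis
  proof (rule tendsto_sandwich[OF _ _ tendsto_const lim])
    show "\<forall>\<^sub>F t in at_top. 0 \<le> t powr - (\<alpha> + 1) / (t * f t)"
      using eventually_ge_at_top[of 0] by eventually_elim (simp add: f_nonneg)
    show "\<forall>\<^sub>F t in at_top. t powr - (\<alpha> + 1) / (t * f t) \<le> 1 / (C * t)"
      using eventually_ge_at_top[of x0]
    proof eventually_elim
      case (elim t)
      have "C * t * t powr - (\<alpha> + 1) \<le> t * f t"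
        using lower[OF elim] x0 elim by (simp add: mult.assoc mult.left_commute)
      then show ?case using x0 elim f_pos[of t] by (simp add: divide_simps mult_ac)
    qed
  qed
qed

lemma sum_f_le_tail_sum:
  assumes "summable (\<lambda>k. f (r * (t + c * real (Suc k))))"
  shows "(\<Sum>k\<in>{1..N}. f (r * (t + c * real k))) \<le> tail_sum r c t"
proof -
  have "(\<Sum>k\<in>{1..N}. f (r * (t + c * real k))) = (\<Sum>k<N. f (r * (t + c * real (Suc k))))"
    by (rule sum.reindex_bij_witness[of _ Suc "\<lambda>k. k - 1"]) auto
  also have "\<dots> \<le> tail_sum r c t"
    unfolding tail_sum_def by (rule sum_le_suminf[OF assms]) (auto simp: f_nonneg)
  finally show ?thesis .
qed

lemma sum_f_tendsto_tail_sum: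
  assumes "summable (\<lambda>k. f (r * (t + c * real (Suc k))))"
  shows "(\<lambda>N. \<Sum>k\<in>{1..N}. f (r * (t + c * real k))) \<longlonglongrightarrow> tail_sum r c t"
proof -
  have "(\<Sum>k\<in>{1..N}. f (r * (t + c * real k))) = (\<Sum>k<N. f (r * (t + c * real (Suc k))))" for N
    by (rule sum.reindex_bij_witness[of _ Suc "\<lambda>k. k - 1"]) auto
  then show ?thesis
    using summable_LIMSEQ[OF assms] by (simp add: tail_sum_def)
qed

end

text \<open>With \<open>u = t + c * n\<close> the exponent splits into \<alpha> + 1 and 3. Of the
  three powers one absorbs the factor \<open>n\<close>, the other two leave a multiple of
  \<open>1 / n ^ 2\<close>.\<close>

lemma sum_mult_powr_bound:
  fixes c t \<alpha> :: real
  assumes "c > 0" "t > 0" "\<alpha> > 0"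
  shows "(\<Sum>n\<in>{1..N}. real n * (t + c * real n) powr - (\<alpha> + 4)) \<le>
    (\<Sum>n. 1 / real (Suc n) ^ 2) / c ^ 3 * t powr - (\<alpha> + 1)"
proof -
  have summ: "summable (\<lambda>n. 1 / real (Suc n) ^ 2)"
    using inverse_power_summable[of 2, where 'a = real] by (subst summable_Suc_iff) (simp add: inverse_eq_divide)
  have term_le: "real n * (t + c * real n) powr - (\<alpha> + 4) \<le> 1 / c ^ 3 * t powr - (\<alpha> + 1) * (1 / real n ^ 2)"
    if "n \<in> {1..N}" for n
  proof -
    define u where "u = t + c * real n"
    have u: "u \<ge> t" "u \<ge> c * real n" "u > 0" "c * real n > 0"
      using assms that by (auto simp: u_def add_pos_nonneg)
    have "real n * u powr - (\<alpha> + 4) \<le> u / c * u powr - (\<alpha> + 4)"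
      using u assms by (intro mult_right_mono) (auto simp: field_simps)
    also have "u / c * u powr - (\<alpha> + 4) = 1 / c * (u powr - (\<alpha> + 1) * (1 / u ^ 2))"
    proof -
      have "u powr - (\<alpha> + 4) = u powr - (\<alpha> + 1) * u powr - 3"
        unfolding powr_add [symmetric] by (rule arg_cong) simp
      also have "u powr - 3 = 1 / u ^ 3" using u by (simp add: powr_minus_divide powr_numeral)
      finally show ?thesis using u by (simp add: power2_eq_square power3_eq_cube)
    qed
    also have "\<dots> \<le> 1 / c * (t powr - (\<alpha> + 1) * (1 / (c * real n) ^ 2))"
      using u assms that by (intro mult_left_mono mult_mono powr_mono2' frac_le power_mono) auto
    also have "\<dots> = 1 / c ^ 3 * t powr - (\<alpha> + 1) * (1 / real n ^ 2)"
      by (simp add: power_mult_distrib power2_eq_square power3_eq_cube)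
    finally show ?thesis by (simp add: u_def)
  qed
  have "(\<Sum>n\<in>{1..N}. real n * (t + c * real n) powr - (\<alpha> + 4)) \<le>
      (\<Sum>n\<in>{1..N}. 1 / c ^ 3 * t powr - (\<alpha> + 1) * (1 / real n ^ 2))"
    by (rule sum_mono) (rule term_le)
  also have "\<dots> = 1 / c ^ 3 * t powr - (\<alpha> + 1) * (\<Sum>n<N. 1 / real (Suc n) ^ 2)"
    unfolding sum_distrib_left
    by (rule sum.reindex_bij_witness[of _ Suc "\<lambda>k. k - 1"]) auto
  also have "\<dots> \<le> 1 / c ^ 3 * t powr - (\<alpha> + 1) * (\<Sum>n. 1 / real (Suc n) ^ 2)"
    using assms by (intro mult_left_mono sum_le_suminf[OF summ]) auto
  finally show ?thesis by (simp add: mult.commute)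
qed

section \<open>Exponential moments of a truncated law\<close>

text \<open>The error is quadratic near 0 but only linear towards minus infinity, so its expectation
  is finite for a law with a mere first moment. The restriction \<open>z \<le> 1\<close> leaves
  large positive values to be handled by the tail.\<close>

lemma exp_le_second_order:
  fixes z :: real
  assumes "z \<le> 1"
  shows "exp z \<le> 1 + z + \<bar>z\<bar> * min \<bar>z\<bar> 1"
proof (cases "z \<ge> 0")
  case True
  then show ?thesis using exp_bound[of z] assms by (simp add: min_def power2_eq_square)
next
  case False
  show ?thesis
  proof (cases "z \<ge> -1")
    case True
    \<comment> \<open>The factor \<open>1 - z\<close> is positive and at most
      \<open>exp (- z)\<close>, while \<open>(1 + z + z * z) * (1 - z)\<close> is
      \<open>1 - z ^ 3\<close>, which exceeds 1 for negative \<open>z\<close>.\<close>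
    have "exp z * (1 - z) \<le> exp z * exp (- z)"
      using exp_ge_add_one_self[of "- z"] by (intro mult_left_mono) auto
    then have "exp z * (1 - z) \<le> 1" by (simp add: exp_minus)
    moreover have "1 \<le> (1 + z + z * z) * (1 - z)"
    proof -
      have "(1 + z + z * z) * (1 - z) = 1 + z * z * (- z)" by algebra
      moreover have "0 \<le> z * z * (- z)" using False by (intro mult_nonneg_nonneg[OF zero_le_square]) auto
      ultimately show ?thesis by linarith
    qed
    ultimately have "exp z * (1 - z) \<le> (1 + z + z * z) * (1 - z)" by linarith
    then have "exp z \<le> 1 + z + z * z" by (rule mult_right_le_imp_le) (use False in simp)
    then show ?thesis using True False by (simp add: min_def)
  next
    case *: False
    then have "exp z \<le> 1" by simp
    then show ?thesis using * False by (simp add: min_def)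
  qed
qed

locale rv_law = real_distribution D + rv_tail f \<alpha>
  for D :: "real measure" and f :: "real \<Rightarrow> real" and \<alpha> :: real +
  assumes f_eq: "f t = measure D {t<..}"
    and D_integrable: "integrable D (\<lambda>x. x)"
begin

abbreviation \<mu> :: real where "\<mu> \<equiv> (LINT x|D. x)"

text \<open>Dominated convergence with majorant \<open>\<bar>x\<bar>\<close> along
  \<open>a = 1 / (n + 1)\<close>; monotonicity in \<open>a\<close> then covers all smaller values.
  It takes the place of a second moment in the expansion of the exponential moment.\<close>

lemma small_second_order_term:
  assumes "\<eta> > 0"
  obtains a0 where "a0 > 0"
    "\<And>a. 0 \<le> a \<Longrightarrow> a \<le> a0 \<Longrightarrow> (LINT x|D. \<bar>x\<bar> * min (a * \<bar>x\<bar>) 1) \<le> \<eta>"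
proof -
  have bnd: "\<bar>x\<bar> * min (a * \<bar>x\<bar>) 1 \<le> \<bar>x\<bar>" "0 \<le> \<bar>x\<bar> * min (a * \<bar>x\<bar>) 1" if "a \<ge> 0" for a x :: real
    using mult_left_mono[of "min (a * \<bar>x\<bar>) 1" 1 "\<bar>x\<bar>"] that by auto
  have nb: "norm (\<bar>x\<bar> * min (a * \<bar>x\<bar>) 1) \<le> norm \<bar>x\<bar>" if "a \<ge> 0" for a x :: real
    unfolding real_norm_def abs_of_nonneg[OF bnd(2)[OF that]] using bnd(1)[OF that] by simp
  have int: "integrable D (\<lambda>x. \<bar>x\<bar> * min (a * \<bar>x\<bar>) 1)" if "a \<ge> 0" for a :: real
    by (rule Bochner_Integration.integrable_bound[OF integrable_abs[OF D_integrable] _ AE_I2[OF nb[OF that]]])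
       measurable
  have "(\<lambda>n. LINT x|D. \<bar>x\<bar> * min (inverse (real (Suc n)) * \<bar>x\<bar>) 1) \<longlonglongrightarrow> (LINT x|D. (0::real))"
  proof (rule integral_dominated_convergence[where w = "\<lambda>x. norm \<bar>x\<bar>"])
    show "AE x in D. (\<lambda>n. \<bar>x\<bar> * min (inverse (real (Suc n)) * \<bar>x\<bar>) 1) \<longlonglongrightarrow> 0"
    proof (rule AE_I2)
      fix x :: real
      have "(\<lambda>n. \<bar>x\<bar> * min (inverse (real (Suc n)) * \<bar>x\<bar>) 1) \<longlonglongrightarrow> \<bar>x\<bar> * min (0 * \<bar>x\<bar>) 1"
        by (intro tendsto_intros LIMSEQ_inverse_real_of_nat)
      then show "(\<lambda>n. \<bar>x\<bar> * min (inverse (real (Suc n)) * \<bar>x\<bar>) 1) \<longlonglongrightarrow> 0" by simp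
    qed
    show "AE x in D. norm (\<bar>x\<bar> * min (inverse (real (Suc n)) * \<bar>x\<bar>) 1) \<le> norm \<bar>x\<bar>" for n
      by (intro AE_I2 nb) simp
    show "(\<lambda>x. \<bar>x\<bar> * min (inverse (real (Suc n)) * \<bar>x\<bar>) 1) \<in> borel_measurable D" for n
      by measurable
    show "integrable D (\<lambda>x. norm \<bar>x\<bar>)"
      using integrable_abs[OF D_integrable] by simp
  qed simp
  then have "eventually (\<lambda>n. (LINT x|D. \<bar>x\<bar> * min (inverse (real (Suc n)) * \<bar>x\<bar>) 1) < \<eta>) sequentially"
    using assms by (intro order_tendstoD(2)[where y = 0]) auto
  then obtain n where n: "(LINT x|D. \<bar>x\<bar> * min (inverse (real (Suc n)) * \<bar>x\<bar>) 1) < \<eta>"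
    by (auto simp: eventually_sequentially)
  have "(LINT x|D. \<bar>x\<bar> * min (a * \<bar>x\<bar>) 1) \<le> \<eta>" if "0 \<le> a" "a \<le> inverse (real (Suc n))" for a
  proof -
    have "(LINT x|D. \<bar>x\<bar> * min (a * \<bar>x\<bar>) 1) \<le> (LINT x|D. \<bar>x\<bar> * min (inverse (real (Suc n)) * \<bar>x\<bar>) 1)"
      using that by (intro integral_mono int mult_left_mono min.mono mult_right_mono) auto
    with n show ?thesis by simp
  qed
  then show thesis using that[of "inverse (real (Suc n))"] by simp
qed

text \<open>The line is cut at \<open>1 / a\<close>, where the second order estimate ceases to
  apply, and not at the truncation level \<open>y\<close>. Beyond the cut the expansion is positive
  and may be kept, so the full mean \<mu> appears instead of a truncated one.\<close>

lemma exp_moment_le: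
  assumes a: "a > 0" and y: "y \<ge> 0"
  shows "(LINT x|D. exp (a * min x y)) \<le>
    1 + a * \<mu> + a * (LINT x|D. \<bar>x\<bar> * min (a * \<bar>x\<bar>) 1) + exp (a * y) * f (1 / a)"
proof -
  have bnd: "0 \<le> \<bar>x\<bar> * min (a * \<bar>x\<bar>) 1" "\<bar>x\<bar> * min (a * \<bar>x\<bar>) 1 \<le> \<bar>x\<bar>" for x :: real
    using mult_left_mono[of "min (a * \<bar>x\<bar>) 1" 1 "\<bar>x\<bar>"] a by auto
  have nb: "norm (\<bar>x\<bar> * min (a * \<bar>x\<bar>) 1) \<le> norm \<bar>x\<bar>" for x :: real
    unfolding real_norm_def abs_of_nonneg[OF bnd(1)] using bnd(2) by simp
  have int: "integrable D (\<lambda>x. \<bar>x\<bar> * min (a * \<bar>x\<bar>) 1)"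
    by (rule Bochner_Integration.integrable_bound[OF integrable_abs[OF D_integrable] _ AE_I2[OF nb]])
       measurable
  have pw: "exp (a * min x y) \<le> 1 + a * x + a * (\<bar>x\<bar> * min (a * \<bar>x\<bar>) 1) + exp (a * y) * indicator {1 / a<..} x"
    for x
  proof (cases "x \<le> 1 / a")
    case True
    have "exp (a * min x y) \<le> exp (a * x)" using a by simp
    also have "\<dots> \<le> 1 + a * x + \<bar>a * x\<bar> * min \<bar>a * x\<bar> 1"
      by (rule exp_le_second_order) (use True a in \<open>auto simp: field_simps\<close>)
    finally show ?thesis using True a by (simp add: abs_mult mult_ac)
  next
    case False
    then have "0 < x" using a by (meson divide_pos_pos less_trans not_le zero_less_one)
    then have "0 \<le> 1 + a * x + a * (\<bar>x\<bar> * min (a * \<bar>x\<bar>) 1)" using a bnd(1)[of x] by (intro add_nonneg_nonneg) auto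
    moreover have "exp (a * min x y) \<le> exp (a * y)" using a by simp
    moreover have "indicator {1 / a<..} x = (1 :: real)" using False by simp
    ultimately show ?thesis by (metis add.commute add_increasing2 mult.right_neutral)
  qed
  have ind: "integrable D (\<lambda>x. exp (a * y) * indicator {1 / a<..} x :: real)"
    by (intro integrable_mult_right integrable_real_indicator) (auto simp: less_top [symmetric])
  have int_exp: "integrable D (\<lambda>x. exp (a * min x y))"
    by (rule integrable_const_bound[of _ "exp (a * y)"]) (use a in auto)
  have "(LINT x|D. exp (a * min x y)) \<le>
      (LINT x|D. 1 + a * x + a * (\<bar>x\<bar> * min (a * \<bar>x\<bar>) 1) + exp (a * y) * indicator {1 / a<..} x)"
    by (intro integral_mono[OF int_exp _ pw] Bochner_Integration.integrable_add integrable_mult_right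
        D_integrable int ind integrable_const)
  also have "\<dots> = 1 + a * \<mu> + a * (LINT x|D. \<bar>x\<bar> * min (a * \<bar>x\<bar>) 1) + exp (a * y) * f (1 / a)"
  proof -
    have i1: "integrable D (\<lambda>x. 1 :: real)" "integrable D (\<lambda>x. a * x)"
      "integrable D (\<lambda>x. a * (\<bar>x\<bar> * min (a * \<bar>x\<bar>) 1))"
      by (intro integrable_const integrable_mult_right D_integrable int)+
    note i2 = Bochner_Integration.integrable_add[OF i1(1,2)]
    note i3 = Bochner_Integration.integrable_add[OF i2 i1(3)]
    have "(LINT x|D. exp (a * y) * indicator {1 / a<..} x) = exp (a * y) * f (1 / a)"
      by (simp add: f_eq)
    then show ?thesis
      unfolding Bochner_Integration.integral_add[OF i3 ind] Bochner_Integration.integral_add[OF i2 i1(3)]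
        Bochner_Integration.integral_add[OF i1(1,2)]
      using prob_space by simp
  qed
  finally show ?thesis .
qed

text \<open>The two-sided truncation behind the weak law for the lower bound.\<close>

lemma truncation_error_small:
  assumes "\<eta> > 0"
  obtains b where "b > 0" "(LINT x|D. \<bar>x - x * indicator {-b..b} x\<bar>) \<le> \<eta>"
proof -
  have "(\<lambda>n. LINT x|D. \<bar>x - x * indicator {-real (Suc n)..real (Suc n)} x\<bar>) \<longlonglongrightarrow> (LINT x|D. (0::real))"
  proof (rule integral_dominated_convergence[where w = "\<lambda>x. \<bar>x\<bar>"])
    show "AE x in D. (\<lambda>n. \<bar>x - x * indicator {-real (Suc n)..real (Suc n)} x\<bar>) \<longlonglongrightarrow> 0"
    proof (rule AE_I2)
      fix x :: real
      obtain N where N: "\<bar>x\<bar> \<le> real N" using real_arch_simple by blast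
      have "\<forall>n\<ge>N. \<bar>x - x * indicator {-real (Suc n)..real (Suc n)} x\<bar> = 0"
        using N by (auto simp: indicator_def)
      then show "(\<lambda>n. \<bar>x - x * indicator {-real (Suc n)..real (Suc n)} x\<bar>) \<longlonglongrightarrow> 0"
        by (intro tendsto_eventually) (auto simp: eventually_sequentially)
    qed
    show "AE x in D. norm \<bar>x - x * indicator {-real (Suc n)..real (Suc n)} x\<bar> \<le> \<bar>x\<bar>" for n
      by (intro AE_I2) (auto simp: indicator_def)
    show "integrable D (\<lambda>x. \<bar>x\<bar>)" by (rule integrable_abs[OF D_integrable])
  qed (simp, measurable)
  then have "eventually (\<lambda>n. (LINT x|D. \<bar>x - x * indicator {-real (Suc n)..real (Suc n)} x\<bar>) < \<eta>) sequentially"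
    using assms by (intro order_tendstoD(2)[where y = 0]) auto
  then obtain n where "(LINT x|D. \<bar>x - x * indicator {-real (Suc n)..real (Suc n)} x\<bar>) < \<eta>"
    by (auto simp: eventually_sequentially)
  then show thesis using that[of "real (Suc n)"] by simp
qed

text \<open>The truncation level may be a small multiple of \<open>u\<close> even though \<open>a\<close> exceeds \<open>1 / u\<close> by a
  logarithm: the truncated part contributes at most \<open>u powr \<kappa> * f (1 / a)\<close>, and \<open>\<kappa>\<close> is below
  the excess of the tail index over \<open>1\<close>.\<close>
lemma exp_moment_bound:
  assumes B: "B > 0" and \<kappa>: "0 < \<kappa>" "\<kappa> < \<alpha> - 1" and \<eta>: "\<eta> > 0"
  obtains u0 where "u0 > 1"
    "\<And>u a y. u \<ge> u0 \<Longrightarrow> 0 \<le> a \<Longrightarrow> a \<le> B * (ln u / u) \<Longrightarrow> 0 \<le> y \<Longrightarrow> a * y \<le> \<kappa> * ln u \<Longrightarrow>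
       (LINT x|D. exp (a * min x y)) \<le> 1 + a * (\<mu> + \<eta>)"
proof -
  obtain a0 where a0: "a0 > 0"
    and small: "\<And>a. 0 \<le> a \<Longrightarrow> a \<le> a0 \<Longrightarrow> (LINT x|D. \<bar>x\<bar> * min (a * \<bar>x\<bar>) 1) \<le> \<eta> / 2"
    using small_second_order_term[of "\<eta> / 2"] \<eta> by auto
  \<comment> \<open>Besides \<open>\<beta> < \<alpha>\<close> for Potter's bound,
    \<open>\<beta> - 1 > \<kappa>\<close> is wanted: up to constants and logarithms
    \<open>a powr (\<beta> - 1)\<close> is at most \<open>u powr - (\<beta> - 1)\<close>, which must
    beat \<open>u powr \<kappa>\<close>. The surplus is \<open>q\<close> below.\<close>
  define \<beta> where "\<beta> = (\<kappa> + 1 + \<alpha>) / 2"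
  have \<beta>: "\<kappa> + 1 < \<beta>" "\<beta> < \<alpha>" using \<kappa> by (auto simp: \<beta>_def)
  obtain x0 C where x0: "x0 > 0" "C > 0"
    and potter: "\<And>x s. x \<ge> x0 \<Longrightarrow> s \<ge> 1 \<Longrightarrow> f (s * x) \<le> C * s powr - \<beta> * f x"
    using potter_upper[of \<beta>] \<beta> \<kappa> by auto
  define C' where "C' = C * x0 powr \<beta> * f x0"
  have C': "C' > 0" using x0 f_pos by (auto simp: C'_def)
  have f_le: "f (1 / a) \<le> C' * a powr \<beta>" if "a > 0" "a \<le> 1 / x0" for a
  proof -
    have "f (1 / a) = f (1 / (a * x0) * x0)" using x0 by simp
    also have "\<dots> \<le> C * (1 / (a * x0)) powr - \<beta> * f x0"
      using that x0 by (intro potter) (auto simp: field_simps)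
    also have "(1 / (a * x0)) powr - \<beta> = a powr \<beta> * x0 powr \<beta>"
      using that x0 by (simp add: powr_divide powr_mult powr_minus)
    finally show ?thesis by (simp add: C'_def mult_ac)
  qed
  have "((\<lambda>u. B * (ln u / u)) \<longlongrightarrow> 0) at_top" by real_asymp
  then have ev1: "eventually (\<lambda>u. B * (ln u / u) < min a0 (1 / x0)) at_top"
    using a0 x0 by (intro order_tendstoD) auto
  define q where "q = \<beta> - 1 - \<kappa>"
  have q: "q > 0" using \<beta> by (simp add: q_def)
  have "((\<lambda>u::real. C' * B powr (\<beta> - 1) * (ln u powr (\<beta> - 1) * u powr - q)) \<longlongrightarrow> 0) at_top"
    using q by real_asymp
  then have ev2: "eventually (\<lambda>u. C' * B powr (\<beta> - 1) * (ln u powr (\<beta> - 1) * u powr - q) < \<eta> / 2) at_top"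
    using \<eta> by (intro order_tendstoD) auto
  have "eventually (\<lambda>u. B * (ln u / u) < min a0 (1 / x0) \<and>
      C' * B powr (\<beta> - 1) * (ln u powr (\<beta> - 1) * u powr - q) < \<eta> / 2 \<and> u > 1) at_top"
    by (intro eventually_conj ev1 ev2 eventually_gt_at_top)
  then obtain u0 where u0: "\<And>u. u \<ge> u0 \<Longrightarrow> B * (ln u / u) < min a0 (1 / x0) \<and>
      C' * B powr (\<beta> - 1) * (ln u powr (\<beta> - 1) * u powr - q) < \<eta> / 2 \<and> u > 1"
    unfolding eventually_at_top_linorder by blast
  have "(LINT x|D. exp (a * min x y)) \<le> 1 + a * (\<mu> + \<eta>)"
    if u: "u \<ge> u0" and a: "0 \<le> a" "a \<le> B * (ln u / u)" and y: "0 \<le> y" "a * y \<le> \<kappa> * ln u" for u a y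
  proof (cases "a = 0")
    \<comment> \<open>Zero weights lead to \<open>a = 0\<close>, where a cut at \<open>1 / a\<close>
      makes no sense; the integrand is then 1.\<close>
    case True
    then show ?thesis by (simp add: prob_space)
  next
    case False
    then have a_pos: "a > 0" using a by simp
    have u1: "u > 1" and a_le: "a \<le> a0" "a \<le> 1 / x0" using u0[OF u] a by auto
    have "exp (a * y) \<le> exp (\<kappa> * ln u)" using y by simp
    also have "\<dots> = u powr \<kappa>" using u1 by (simp add: powr_def)
    finally have "exp (a * y) * f (1 / a) \<le> u powr \<kappa> * (C' * a powr \<beta>)"
      using f_le[OF a_pos a_le(2)] f_nonneg by (intro mult_mono) auto
    \<comment> \<open>One factor \<open>a\<close> is set aside: the error has to be proportional to
      \<open>a\<close> in order to be absorbed by the drift \<open>a * \<mu>\<close>.\<close>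
    also have "a powr \<beta> = a * a powr (\<beta> - 1)" using a_pos by (simp add: powr_diff)
    also have "u powr \<kappa> * (C' * (a * a powr (\<beta> - 1))) \<le> u powr \<kappa> * (C' * (a * (B * (ln u / u)) powr (\<beta> - 1)))"
      using a a_pos C' \<beta> \<kappa> by (intro mult_left_mono powr_mono2) auto
    also have "(B * (ln u / u)) powr (\<beta> - 1) = B powr (\<beta> - 1) * ln u powr (\<beta> - 1) * u powr - (\<beta> - 1)"
      using B u1 powr_minus_divide[of u "\<beta> - 1"] by (simp add: powr_mult powr_divide)
    also have "u powr \<kappa> * (C' * (a * (B powr (\<beta> - 1) * ln u powr (\<beta> - 1) * u powr - (\<beta> - 1)))) =
        a * (C' * B powr (\<beta> - 1) * (ln u powr (\<beta> - 1) * (u powr \<kappa> * u powr - (\<beta> - 1))))"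
      by (simp only: mult_ac)
    also have "u powr \<kappa> * u powr - (\<beta> - 1) = u powr - q"
      by (simp add: powr_add [symmetric] q_def algebra_simps)
    also have "a * (C' * B powr (\<beta> - 1) * (ln u powr (\<beta> - 1) * u powr - q)) \<le> a * (\<eta> / 2)"
      using u0[OF u] a by (intro mult_left_mono) auto
    finally have "exp (a * y) * f (1 / a) \<le> a * (\<eta> / 2)" .
    moreover have "a * (LINT x|D. \<bar>x\<bar> * min (a * \<bar>x\<bar>) 1) \<le> a * (\<eta> / 2)"
      using small[OF a(1) a_le(1)] a by (intro mult_left_mono) auto
    ultimately show ?thesis
      using exp_moment_le[OF a_pos y(1)] by (simp add: algebra_simps)
  qed
  moreover have "u0 > 1" using u0[of u0] by simp
  ultimately show thesis using that[of u0] by blast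
qed

end

section \<open>Sums of independent variables\<close>

context prob_space
begin

text \<open>The cross terms vanish by independence and centring. The lemma will be applied to
  truncated variables, which are bounded although the original law may lack a second moment.\<close>

lemma second_moment_indep_sum:
  fixes Z :: "'i \<Rightarrow> 'a \<Rightarrow> real" and B :: real
  assumes "finite J" "indep_vars (\<lambda>_. borel) Z J"
    and "\<And>j \<omega>. j \<in> J \<Longrightarrow> \<bar>Z j \<omega>\<bar> \<le> B" and "\<And>j. j \<in> J \<Longrightarrow> expectation (Z j) = 0"
  shows "integrable M (\<lambda>\<omega>. (\<Sum>j\<in>J. Z j \<omega>)\<^sup>2) \<and> expectation (\<lambda>\<omega>. (\<Sum>j\<in>J. Z j \<omega>)\<^sup>2) \<le> card J * B\<^sup>2"
  using assms
proof (induction J rule: finite_induct)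
  case (insert i J)
  define T where "T \<omega> = (\<Sum>j\<in>J. Z j \<omega>)" for \<omega>
  have Z_meas: "Z j \<in> borel_measurable M" if "j \<in> insert i J" for j
    using insert.prems(1) that by (auto simp: indep_vars_def)
  have Z_int: "integrable M (Z j)" if "j \<in> insert i J" for j
    using insert.prems(2) Z_meas that by (intro integrable_const_bound[of _ B]) auto
  have IH: "integrable M (\<lambda>\<omega>. (T \<omega>)\<^sup>2)" "expectation (\<lambda>\<omega>. (T \<omega>)\<^sup>2) \<le> card J * B\<^sup>2"
    using insert.IH[OF indep_vars_subset[OF insert.prems(1)]] insert.prems by (auto simp: T_def)
  have T_int: "integrable M T" unfolding T_def[abs_def] by (intro Bochner_Integration.integrable_sum Z_int) auto
  have ET: "expectation T = 0"
    unfolding T_def[abs_def] using insert.prems(3) Z_int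
    by (subst Bochner_Integration.integral_sum) auto
  have "indep_var borel (Z i) borel T"
    unfolding T_def[abs_def] by (rule indep_vars_sum[OF insert.hyps insert.prems(1)])
  then have cross: "integrable M (\<lambda>\<omega>. Z i \<omega> * T \<omega>)" "expectation (\<lambda>\<omega>. Z i \<omega> * T \<omega>) = 0"
    using indep_var_integrable[OF _ Z_int[of i] T_int] indep_var_lebesgue_integral[OF _ Z_int[of i] T_int] ET
    by auto
  have Zi2_le: "(Z i \<omega>)\<^sup>2 \<le> B\<^sup>2" for \<omega>
    using power_mono[OF insert.prems(2)[of i \<omega>], of 2] by simp
  have Zi2: "integrable M (\<lambda>\<omega>. (Z i \<omega>)\<^sup>2)"
    using Z_meas[of i] Zi2_le by (intro integrable_const_bound[of _ "B\<^sup>2"]) auto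
  have eq: "(\<Sum>j\<in>insert i J. Z j \<omega>)\<^sup>2 = (Z i \<omega>)\<^sup>2 + 2 * (Z i \<omega> * T \<omega>) + (T \<omega>)\<^sup>2" for \<omega>
    using insert.hyps by (simp add: T_def power2_sum)
  have int: "integrable M (\<lambda>\<omega>. (Z i \<omega>)\<^sup>2 + 2 * (Z i \<omega> * T \<omega>) + (T \<omega>)\<^sup>2)"
    by (intro Bochner_Integration.integrable_add integrable_mult_right Zi2 cross(1) IH(1))
  have "expectation (\<lambda>\<omega>. (Z i \<omega>)\<^sup>2 + 2 * (Z i \<omega> * T \<omega>) + (T \<omega>)\<^sup>2) =
      expectation (\<lambda>\<omega>. (Z i \<omega>)\<^sup>2) + expectation (\<lambda>\<omega>. (T \<omega>)\<^sup>2)"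
    using Zi2 cross IH(1) by simp
  also have "expectation (\<lambda>\<omega>. (Z i \<omega>)\<^sup>2) \<le> B\<^sup>2"
    by (rule integral_le_const[OF Zi2]) (use Zi2_le in auto)
  finally have "expectation (\<lambda>\<omega>. (Z i \<omega>)\<^sup>2 + 2 * (Z i \<omega> * T \<omega>) + (T \<omega>)\<^sup>2) \<le> card (insert i J) * B\<^sup>2"
    using IH(2) insert.hyps by (simp add: algebra_simps)
  with int show ?case unfolding eq by blast
qed simp

text \<open>The \<open>A i\<close> may depend on each other, but they lie in events
  \<open>B i\<close> whose pairwise intersections factorize, and that controls the overlaps. The
  square overcounts the pairs, which lets the induction close easily.\<close>

lemma bonferroni_lower_bound:
  assumes "finite I" and "\<And>i. i \<in> I \<Longrightarrow> A i \<in> events" and "\<And>i. i \<in> I \<Longrightarrow> B i \<in> events"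
    and "\<And>i. i \<in> I \<Longrightarrow> A i \<subseteq> B i"
    and "\<And>i j. i \<in> I \<Longrightarrow> j \<in> I \<Longrightarrow> i \<noteq> j \<Longrightarrow> prob (B i \<inter> B j) = prob (B i) * prob (B j)"
  shows "prob (\<Union>i\<in>I. A i) \<ge> (\<Sum>i\<in>I. prob (A i)) - (\<Sum>i\<in>I. prob (B i))\<^sup>2"
  using assms
proof (induction I rule: finite_induct)
  case (insert i I)
  define U where "U = (\<Union>j\<in>I. A j)"
  define s where "s = (\<Sum>j\<in>I. prob (B j))"
  have U: "U \<in> events" unfolding U_def using insert.hyps insert.prems by (intro sets.finite_UN) auto
  have IH: "prob U \<ge> (\<Sum>j\<in>I. prob (A j)) - s\<^sup>2"
    unfolding U_def s_def using insert.prems by (intro insert.IH) auto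
  have "A i \<inter> U \<subseteq> (\<Union>j\<in>I. B i \<inter> B j)"
    using insert.prems(3) unfolding U_def by blast
  then have "prob (A i \<inter> U) \<le> prob (\<Union>j\<in>I. B i \<inter> B j)"
    using insert.hyps insert.prems by (intro finite_measure_mono sets.finite_UN) auto
  also have "\<dots> \<le> (\<Sum>j\<in>I. prob (B i \<inter> B j))"
    using insert.hyps insert.prems by (intro measure_UNION_le) auto
  also have "\<dots> = (\<Sum>j\<in>I. prob (B i) * prob (B j))"
    using insert.hyps insert.prems(4) by (intro sum.cong refl) auto
  also have "\<dots> = prob (B i) * s" by (simp add: s_def sum_distrib_left)
  finally have "prob (A i \<inter> U) \<le> prob (B i) * s" .
  moreover have "prob (A i \<union> U) = prob (A i) + prob U - prob (A i \<inter> U)"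
    using measure_Un3[of "A i" M U] U insert.prems(1)[of i] by (simp add: fmeasurable_eq_sets)
  moreover have "(prob (B i) + s)\<^sup>2 \<ge> s\<^sup>2 + prob (B i) * s"
  proof -
    have "(prob (B i) + s)\<^sup>2 = s\<^sup>2 + prob (B i) * s + ((prob (B i))\<^sup>2 + prob (B i) * s)"
      by (simp add: power2_sum)
    moreover have "s \<ge> 0" by (simp add: s_def sum_nonneg)
    ultimately show ?thesis by simp
  qed
  ultimately have "prob (A i \<union> U) \<ge> prob (A i) + (\<Sum>j\<in>I. prob (A j)) - (prob (B i) + s)\<^sup>2"
    using IH by linarith
  then show ?case using insert.hyps by (simp add: U_def s_def)
qed simp

end

lemma weighted_sum_reindex:
  fixes w z :: "nat \<Rightarrow> real"
  shows "(\<Sum>i<n. w i * z (n - i)) = (\<Sum>j\<in>{1..n}. w (n - j) * z j)"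
  by (rule sum.reindex_bij_witness[of _ "\<lambda>j. n - j" "\<lambda>i. n - i"]) auto

text \<open>Cesaro averaging with an explicit error. The constant \<open>K\<close> is the same for
  all \<open>n\<close>, because the process is considered at all times at once.\<close>

lemma partial_sum_deviation:
  fixes w :: "nat \<Rightarrow> real" and l \<eta> :: real
  assumes "w \<longlonglongrightarrow> l" "\<eta> > 0"
  obtains K where "K \<ge> 0" "\<And>n. \<bar>(\<Sum>i<n. w i) - l * real n\<bar> \<le> \<eta> * real n + K"
proof -
  obtain N where N: "\<And>i. i \<ge> N \<Longrightarrow> \<bar>w i - l\<bar> < \<eta>"
    using LIMSEQ_D[OF assms] by auto
  define K where "K = (\<Sum>i<N. \<bar>w i - l\<bar>)"
  have "\<bar>(\<Sum>i<n. w i) - l * real n\<bar> \<le> \<eta> * real n + K" for n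
  proof -
    have "\<bar>(\<Sum>i<n. w i) - l * n\<bar> = \<bar>\<Sum>i<n. w i - l\<bar>"
      by (simp add: sum_subtractf mult.commute)
    also have "\<dots> \<le> (\<Sum>i<n. \<bar>w i - l\<bar>)" by (rule sum_abs)
    also have "\<dots> \<le> (\<Sum>i<n. \<eta> + (if i < N then \<bar>w i - l\<bar> else 0))"
      using N assms(2) by (intro sum_mono) (auto simp: not_less intro: less_imp_le)
    also have "\<dots> = \<eta> * n + (\<Sum>i\<in>{..<n} \<inter> {..<N}. \<bar>w i - l\<bar>)"
      by (simp add: sum.distrib sum.inter_restrict)
    also have "\<dots> \<le> \<eta> * n + K"
      unfolding K_def by (intro add_left_mono sum_mono2) auto
    finally show ?thesis .
  qed
  moreover have "K \<ge> 0" by (simp add: K_def sum_nonneg)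
  ultimately show thesis using that by blast
qed

section \<open>Upper bound\<close>

locale iid_walk = prob_space P + law: rv_law D f \<alpha>
  for P :: "'a measure" and D :: "real measure" and f :: "real \<Rightarrow> real" and \<alpha> :: real +
  fixes X :: "nat \<Rightarrow> 'a \<Rightarrow> real" and w :: "nat \<Rightarrow> real" and w_inf :: real
  assumes indep: "indep_vars (\<lambda>_. borel) X {1..}"
    and distr_X: "n \<ge> 1 \<Longrightarrow> distr P borel (X n) = D"
    and mean_neg: "law.\<mu> < 0"
    and w_nonneg: "w n \<ge> 0"
    and w_lim: "w \<longlonglongrightarrow> w_inf"
    and w_inf_pos: "w_inf > 0"
begin

definition c :: real where "c = - law.\<mu> * w_inf"
definition G :: real where "G = (SUP i. w i)"
definition S :: "nat \<Rightarrow> 'a \<Rightarrow> real" where "S n \<omega> = (\<Sum>i<n. w i * X (n - i) \<omega>)"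

lemma c_pos: "c > 0" using mean_neg w_inf_pos by (auto simp: c_def mult_less_0_iff)

lemma w_bdd: "bdd_above (range w)"
  using w_lim by (simp add: Bseq_bdd_above convergentI convergent_imp_Bseq)

lemma w_le_G: "w i \<le> G"
  unfolding G_def by (rule cSUP_upper[OF _ w_bdd]) auto

lemma w_inf_le_G: "w_inf \<le> G"
  by (rule LIMSEQ_le_const2[OF w_lim]) (use w_le_G in auto)

lemma G_pos: "G > 0" using w_inf_pos w_inf_le_G by linarith

lemma X_meas [measurable]: "n \<ge> 1 \<Longrightarrow> X n \<in> borel_measurable P"
  using indep by (auto simp: indep_vars_def)

lemma S_eq: "S n \<omega> = (\<Sum>j\<in>{1..n}. w (n - j) * X j \<omega>)"
  unfolding S_def by (rule weighted_sum_reindex)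

lemma S_meas [measurable]: "S n \<in> borel_measurable P"
  unfolding S_eq[abs_def] by (intro borel_measurable_sum borel_measurable_times X_meas) auto

lemma expectation_X:
  assumes "n \<ge> 1" and [measurable]: "h \<in> borel_measurable borel"
  shows "expectation (\<lambda>\<omega>. h (X n \<omega>)) = (LINT x|D. h x :: real)"
  using assms by (subst distr_X[OF assms(1), symmetric], subst integral_distr) auto

lemma integrable_X:
  assumes "n \<ge> 1" and [measurable]: "h \<in> borel_measurable borel" and "integrable D h"
  shows "integrable P (\<lambda>\<omega>. h (X n \<omega>) :: real)"
  using assms by (metis distr_X integrable_distr X_meas)

lemma prob_X_gt: "n \<ge> 1 \<Longrightarrow> prob {\<omega> \<in> space P. X n \<omega> > t} = f t"
  by (simp add: law.f_eq distr_X[symmetric] measure_distr vimage_def Int_def conj_commute)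

text \<open>The index set is arbitrary because the position of the exempted jump will be left out.
  Truncation from above, with nonnegative weights, bounds the exponentials.\<close>

lemma chernoff:
  assumes J: "finite J" "J \<subseteq> {1..}" and h: "h > 0" and v: "\<And>j. j \<in> J \<Longrightarrow> 0 \<le> v j"
  shows "prob {\<omega> \<in> space P. s \<le> (\<Sum>j\<in>J. v j * min (X j \<omega>) y)} \<le>
    exp (- h * s) * (\<Prod>j\<in>J. LINT x|D. exp (h * v j * min x y))"
proof -
  define Y where "Y j \<omega> = exp (h * v j * min (X j \<omega>) y)" for j \<omega>
  have Y_int: "integrable P (Y j)" if "j \<in> J" for j
  proof (rule integrable_const_bound[of _ "exp (h * v j * y)"])
    show "Y j \<in> borel_measurable P"
      using that J unfolding Y_def by (intro measurable_compose[OF X_meas]) auto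
    show "AE \<omega> in P. norm (Y j \<omega>) \<le> exp (h * v j * y)"
      using h v[OF that] by (intro AE_I2) (auto simp: Y_def mult_left_mono)
  qed
  have Y_indep: "indep_vars (\<lambda>_. borel) Y J"
    unfolding Y_def by (rule indep_vars_compose2[OF indep_vars_subset[OF indep J(2)]]) measurable
  have prod_int: "integrable P (\<lambda>\<omega>. \<Prod>j\<in>J. Y j \<omega>)"
    by (rule indep_vars_integrable[OF J(1) Y_indep Y_int])
  have prod_eq: "(\<Prod>j\<in>J. Y j \<omega>) = exp (h * (\<Sum>j\<in>J. v j * min (X j \<omega>) y))" for \<omega>
    unfolding Y_def using J(1) by (simp add: exp_sum [symmetric] sum_distrib_left mult.assoc)
  have "prob {\<omega> \<in> space P. s \<le> (\<Sum>j\<in>J. v j * min (X j \<omega>) y)} =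
      prob {\<omega> \<in> space P. exp (h * s) \<le> (\<Prod>j\<in>J. Y j \<omega>)}"
    using h by (simp add: prod_eq)
  also have "\<dots> \<le> expectation (\<lambda>\<omega>. \<Prod>j\<in>J. Y j \<omega>) / exp (h * s)"
    by (rule integral_Markov_inequality_measure[OF prod_int]) (auto simp: Y_def intro!: prod_nonneg)
  also have "expectation (\<lambda>\<omega>. \<Prod>j\<in>J. Y j \<omega>) = (\<Prod>j\<in>J. expectation (Y j))"
    by (rule indep_vars_lebesgue_integral[OF J(1) Y_indep Y_int])
  also have "\<dots> = (\<Prod>j\<in>J. LINT x|D. exp (h * v j * min x y))"
    unfolding Y_def using J by (intro prod.cong refl expectation_X) auto
  finally show ?thesis by (simp add: exp_minus divide_inverse mult.commute)
qed

text \<open>Chernoff's inequality with \<open>h = K * ln u / u\<close>, where \<open>u = t + c * n\<close>: this order of \<open>h\<close>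
  makes the bound polynomial in \<open>u\<close> of prescribed degree, and then \<open>\<delta>\<close> is taken so small that
  truncating at \<open>\<delta> * u\<close> leaves the exponential moments under control.\<close>
lemma no_big_jump_bound:
  assumes \<epsilon>: "0 < \<epsilon>" "\<epsilon> < 1" and p: "p > 0"
  obtains \<delta> C u0 where "\<delta> > 0" "C > 0"
    "\<And>t n k. t \<ge> u0 \<Longrightarrow> k \<in> {1..n} \<Longrightarrow>
      prob {\<omega> \<in> space P. \<epsilon> * t - (1 - \<epsilon>) * c * n \<le> (\<Sum>j\<in>{1..n} - {k}. w (n - j) * min (X j \<omega>) (\<delta> * (t + c * n)))}
      \<le> C * (t + c * n) powr - p"
proof -
  \<comment> \<open>\<open>K\<close> makes \<open>h * (\<epsilon> / 2 * u)\<close> equal to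
    \<open>p * ln u\<close>; \<delta> makes the largest exponent
    \<open>K * G * (ln u / u) * (\<delta> * u)\<close> equal to \<open>\<kappa> * ln u\<close>; and
    \<eta> ensures \<open>(1 - \<eta>)\<^sup>2 \<ge> 1 - \<epsilon> / 2\<close>.\<close>
  define K where "K = 2 * p / \<epsilon>"
  define \<kappa> where "\<kappa> = (\<alpha> - 1) / 2"
  define \<delta> where "\<delta> = \<kappa> / (K * G)"
  define \<eta> where "\<eta> = \<epsilon> / 4"
  have K: "K > 0" using \<epsilon> p by (simp add: K_def)
  have \<kappa>: "0 < \<kappa>" "\<kappa> < \<alpha> - 1" using law.\<alpha>_gt_1 by (auto simp: \<kappa>_def)
  have \<delta>: "\<delta> > 0" using \<kappa> K G_pos by (simp add: \<delta>_def)
  have \<eta>: "\<eta> > 0" using \<epsilon> by (simp add: \<eta>_def)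
  obtain u0 where u0: "u0 > 1" and mom:
    "\<And>u a y. u \<ge> u0 \<Longrightarrow> 0 \<le> a \<Longrightarrow> a \<le> K * G * (ln u / u) \<Longrightarrow> 0 \<le> y \<Longrightarrow> a * y \<le> \<kappa> * ln u \<Longrightarrow>
       (LINT x|D. exp (a * min x y)) \<le> 1 + a * (law.\<mu> + \<eta> * - law.\<mu>)"
    using law.exp_moment_bound[of "K * G" \<kappa> "\<eta> * - law.\<mu>"] K G_pos \<kappa> \<eta> mean_neg
    by (auto simp: mult_pos_neg)
  obtain K0 where K0: "K0 \<ge> 0" "\<And>n. \<bar>(\<Sum>i<n. w i) - w_inf * n\<bar> \<le> (\<eta> * w_inf) * n + K0"
    using partial_sum_deviation[OF w_lim, of "\<eta> * w_inf"] \<eta> w_inf_pos by auto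
  define C1 where "C1 = - law.\<mu> * (K0 + G)"
  have C1: "C1 \<ge> 0" using K0 G_pos mean_neg by (auto simp: C1_def mult_nonpos_nonneg)
  have "prob {\<omega> \<in> space P. \<epsilon> * t - (1 - \<epsilon>) * c * n \<le> (\<Sum>j\<in>{1..n} - {k}. w (n - j) * min (X j \<omega>) (\<delta> * (t + c * n)))}
      \<le> exp (K * C1) * (t + c * n) powr - p"
    if t: "t \<ge> u0" and k: "k \<in> {1..n}" for t n k
  proof -
    define u where "u = t + c * n"
    have u: "u \<ge> u0" using t c_pos by (simp add: u_def add_increasing2)
    then have u1: "u > 1" using u0 by simp
    define h where "h = K * (ln u / u)"
    have h: "h > 0" using K u1 by (simp add: h_def)
    \<comment> \<open>Boundedness of \<open>h\<close> turns the additive constant \<open>C1\<close>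
      in the exponent into the constant factor \<open>exp (K * C1)\<close>.\<close>
    have "ln u \<le> u - 1" using u1 by (intro ln_le_minus_one) auto
    then have "ln u / u \<le> 1" using u1 by simp
    then have h_le: "h \<le> K" using K mult_left_mono[of "ln u / u" 1 K] by (simp add: h_def)
    define J where "J = {1..n} - {k}"
    define m where "m = law.\<mu> * (1 - \<eta>)"
    have m: "m \<le> 0" using mean_neg \<epsilon> by (auto simp: m_def \<eta>_def mult_le_0_iff)
    have moment: "(LINT x|D. exp (h * w i * min x (\<delta> * u))) \<le> exp (h * w i * m)" for i
    proof -
      have "h * w i \<le> h * G" using w_le_G h by (intro mult_left_mono) auto
      then have a: "h * w i \<le> K * G * (ln u / u)" by (simp add: h_def mult_ac)
      have "h * w i * (\<delta> * u) \<le> K * G * (ln u / u) * (\<delta> * u)"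
        using a \<delta> u1 by (intro mult_right_mono) auto
      also have "\<dots> = \<kappa> * ln u" using u1 K G_pos by (simp add: \<delta>_def)
      finally have "(LINT x|D. exp (h * w i * min x (\<delta> * u))) \<le> 1 + h * w i * (law.\<mu> + \<eta> * - law.\<mu>)"
        using a h w_nonneg \<delta> u1 by (intro mom[OF u]) auto
      also have "law.\<mu> + \<eta> * - law.\<mu> = m" by (simp add: m_def algebra_simps)
      also have "1 + h * w i * m \<le> exp (h * w i * m)" by (rule exp_ge_add_one_self)
      finally show ?thesis .
    qed
    define Q where "Q = (\<Sum>j\<in>J. w (n - j))"
    \<comment> \<open>Leaving out the index \<open>k\<close> costs at most \<open>G\<close> in the
      sum of the weights, whence the \<open>G\<close> in \<open>C1\<close>.\<close>
    have "Q + w (n - k) = (\<Sum>j\<in>{1..n}. w (n - j))"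
      unfolding Q_def J_def using k by (subst sum.remove[of "{1..n}" k]) auto
    also have "\<dots> = (\<Sum>i<n. w i)" using weighted_sum_reindex[of w "\<lambda>_. 1" n] by simp
    also have "\<dots> \<ge> w_inf * n - (\<eta> * w_inf * n + K0)" using K0(2)[of n] by linarith
    finally have Q: "Q \<ge> (1 - \<eta>) * w_inf * n - (K0 + G)"
      using w_le_G[of "n - k"] by (simp add: algebra_simps)
    have "m * Q \<le> m * ((1 - \<eta>) * w_inf * n - (K0 + G))"
      using Q m by (rule mult_left_mono_neg)
    also have "\<dots> = - (1 - \<eta>)\<^sup>2 * c * n + (1 - \<eta>) * C1"
      by (simp add: m_def c_def C1_def power2_eq_square algebra_simps)
    also have "\<dots> \<le> - (1 - 2 * \<eta>) * c * n + C1"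
    proof -
      have "(1 - 2 * \<eta>) * (c * n) \<le> (1 - \<eta>)\<^sup>2 * (c * n)"
        using c_pos by (intro mult_right_mono) (auto simp: power2_eq_square algebra_simps)
      moreover have "(1 - \<eta>) * C1 \<le> C1" using C1 \<eta> by (simp add: algebra_simps)
      ultimately show ?thesis by (simp add: algebra_simps)
    qed
    finally have mQ: "m * Q \<le> - (1 - \<epsilon> / 2) * c * n + C1" by (simp add: \<eta>_def)
    have "prob {\<omega> \<in> space P. \<epsilon> * t - (1 - \<epsilon>) * c * n \<le> (\<Sum>j\<in>J. w (n - j) * min (X j \<omega>) (\<delta> * u))}
        \<le> exp (- h * (\<epsilon> * t - (1 - \<epsilon>) * c * n)) * (\<Prod>j\<in>J. LINT x|D. exp (h * w (n - j) * min x (\<delta> * u)))"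
      by (rule chernoff[OF _ _ h]) (auto simp: J_def w_nonneg)
    also have "\<dots> \<le> exp (- h * (\<epsilon> * t - (1 - \<epsilon>) * c * n)) * (\<Prod>j\<in>J. exp (h * w (n - j) * m))"
      by (intro mult_left_mono prod_mono conjI moment) (auto intro!: integral_nonneg_AE)
    also have "(\<Prod>j\<in>J. exp (h * w (n - j) * m)) = exp (h * (m * Q))"
      by (simp add: exp_sum [symmetric] J_def Q_def sum_distrib_left mult_ac)
    also have "exp (- h * (\<epsilon> * t - (1 - \<epsilon>) * c * n)) * exp (h * (m * Q)) =
        exp (h * (m * Q - (\<epsilon> * t - (1 - \<epsilon>) * c * n)))"
      by (simp add: exp_add [symmetric] algebra_simps)
    also have "\<dots> \<le> exp (K * C1 - p * ln u)"
    proof -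
      \<comment> \<open>The threshold lies \<open>\<epsilon> * u\<close> above the typical value
        \<open>- c * n\<close>. The errors in mean and weights consume
        \<open>\<epsilon> / 2 * c * n\<close> of this gap, so at least
        \<open>\<epsilon> / 2 * u\<close> is left, up to \<open>C1\<close>.\<close>
      have "m * Q - (\<epsilon> * t - (1 - \<epsilon>) * c * n) \<le> C1 - \<epsilon> / 2 * u - \<epsilon> / 2 * t"
        using mQ by (simp add: u_def algebra_simps)
      also have "\<dots> \<le> C1 - \<epsilon> / 2 * u" using \<epsilon> t u0 by simp
      finally have "h * (m * Q - (\<epsilon> * t - (1 - \<epsilon>) * c * n)) \<le> h * (C1 - \<epsilon> / 2 * u)"
        using h by (intro mult_left_mono) auto
      also have "\<dots> = h * C1 - p * ln u" using u1 \<epsilon> by (simp add: h_def K_def field_simps)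
      also have "\<dots> \<le> K * C1 - p * ln u" using h_le C1 by (intro diff_right_mono mult_right_mono) auto
      finally show ?thesis by simp
    qed
    also have "\<dots> = exp (K * C1) * u powr - p"
      using u1 by (simp add: powr_def exp_diff exp_minus divide_inverse)
    finally show ?thesis by (simp add: J_def u_def)
  qed
  then show thesis using that[of \<delta> "exp (K * C1)" u0] \<delta> by simp
qed

text \<open>The event that the supremum is above \<open>t\<close>, written without the supremum: no
  extended reals occur, and it is a countable union of measurable events.\<close>

definition exceeds :: "real \<Rightarrow> 'a set" where
  "exceeds t = {\<omega> \<in> space P. \<exists>n. S n \<omega> > t}"

lemma exceeds_sets [measurable]: "exceeds t \<in> sets P"
  unfolding exceeds_def by measurable

lemma prob_X_and_sum:
  assumes J: "finite J" "J \<subseteq> {1..}" "i \<notin> J" "i \<ge> 1"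
  shows "prob {\<omega> \<in> space P. X i \<omega> > a \<and> (\<Sum>j\<in>J. v j * X j \<omega>) > b} =
    f a * prob {\<omega> \<in> space P. (\<Sum>j\<in>J. v j * X j \<omega>) > b}"
proof -
  \<comment> \<open>Weight 1 at \<open>i\<close> places \<open>X i\<close> itself in the weighted
    family, which can then be split into one member and the sum of others; since
    \<open>i \<notin> J\<close>, that sum is unchanged.\<close>
  define v' where "v' = v(i := 1)"
  have "indep_vars (\<lambda>_. borel) (\<lambda>j \<omega>. v' j * X j \<omega>) (insert i J)"
    by (rule indep_vars_compose2[OF indep_vars_subset[OF indep]]) (use J in auto)
  then have "indep_var borel (\<lambda>\<omega>. v' i * X i \<omega>) borel (\<lambda>\<omega>. \<Sum>j\<in>J. v' j * X j \<omega>)"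
    by (rule indep_vars_sum[OF J(1,3)])
  also have "(\<lambda>\<omega>. v' i * X i \<omega>) = X i" by (simp add: v'_def)
  also have "(\<lambda>\<omega>. \<Sum>j\<in>J. v' j * X j \<omega>) = (\<lambda>\<omega>. \<Sum>j\<in>J. v j * X j \<omega>)"
    using J(3) by (auto simp: v'_def intro!: sum.cong)
  finally have *: "indep_var borel (X i) borel (\<lambda>\<omega>. \<Sum>j\<in>J. v j * X j \<omega>)" .
  have "prob {\<omega> \<in> space P. X i \<omega> > a \<and> (\<Sum>j\<in>J. v j * X j \<omega>) > b} =
      prob {\<omega> \<in> space P. X i \<omega> > a} * prob {\<omega> \<in> space P. (\<Sum>j\<in>J. v j * X j \<omega>) > b}"
    using indep_varD[OF *, of "{a<..}" "{b<..}"] by (simp add: vimage_def Int_def conj_ac)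
  then show ?thesis using prob_X_gt[OF J(4)] by simp
qed

lemma prob_two_jumps:
  assumes "i \<ge> 1" "j \<ge> 1" "i \<noteq> j"
  shows "prob {\<omega> \<in> space P. X i \<omega> > a \<and> X j \<omega> > b} = f a * f b"
  using prob_X_and_sum[of "{j}" i a b "\<lambda>_. 1"] assms prob_X_gt[of j b] by simp

text \<open>Apart from one large jump or two moderate ones, the level can only be passed in the presence of
  at most one moderate jump, at \<open>k\<close> say. That jump contributes at most
  \<open>(1 - \<epsilon>) * (t + c * n)\<close>, so the other summands, all truncated, must make up the rest.\<close>
lemma exceeds_decomposition:
  assumes \<epsilon>: "0 < \<epsilon>" "\<epsilon> < 1" and \<delta>: "\<delta> > 0" and t: "t > 0"
    and S_gt: "S n \<omega> > t" and n: "n \<le> N"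
  shows "(\<exists>k\<in>{1..N}. X k \<omega> > (1 - \<epsilon>) / G * (t + c * k)) \<or>
    (\<exists>i\<in>{1..N}. \<exists>j\<in>{1..N}. i \<noteq> j \<and> X i \<omega> > \<delta> * (t + c * i) \<and> X j \<omega> > \<delta> * (t + c * j)) \<or>
    (\<exists>n\<in>{1..N}. \<exists>k\<in>{1..n}. \<epsilon> * t - (1 - \<epsilon>) * c * n \<le>
       (\<Sum>j\<in>{1..n} - {k}. w (n - j) * min (X j \<omega>) (\<delta> * (t + c * n))))"
  (is "?A \<or> ?B \<or> ?C")
proof (rule ccontr)
  assume "\<not> ?thesis"
  then have neg: "\<not> ?A" "\<not> ?B" "\<not> ?C" by blast+
  have no1: "X k \<omega> \<le> (1 - \<epsilon>) / G * (t + c * k)" if "k \<in> {1..N}" for k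
    using neg(1) that by (meson not_less)
  have no2: "X j \<omega> \<le> \<delta> * (t + c * j)"
    if "i \<in> {1..N}" "j \<in> {1..N}" "i \<noteq> j" "X i \<omega> > \<delta> * (t + c * i)" for i j
    using neg(2) that by (meson not_less)
  have no3: "(\<Sum>j\<in>{1..n} - {k}. w (n - j) * min (X j \<omega>) (\<delta> * (t + c * n))) < \<epsilon> * t - (1 - \<epsilon>) * c * n"
    if "n \<in> {1..N}" "k \<in> {1..n}" for n k
    using neg(3) that by (meson not_less)
  have n1: "n \<ge> 1"
  proof (rule ccontr)
    assume "\<not> n \<ge> 1"
    then have "n = 0" by simp
    then have "S n \<omega> = 0" by (simp add: S_def)
    with S_gt t show False by simp
  qed
  \<comment> \<open>\<open>k\<close> is the only index that may carry a moderate jump. If there is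
    no such jump, any index will do, and \<open>n\<close> is at hand because
    \<open>n \<ge> 1\<close>.\<close>
  obtain k where k: "k \<in> {1..n}" and others: "\<And>j. j \<in> {1..n} - {k} \<Longrightarrow> X j \<omega> \<le> \<delta> * (t + c * j)"
  proof (cases "\<exists>k\<in>{1..n}. X k \<omega> > \<delta> * (t + c * k)")
    case True
    then obtain k where "k \<in> {1..n}" "X k \<omega> > \<delta> * (t + c * k)" by blast
    then show thesis using no2[of k] n by (intro that[of k]) auto
  next
    case False
    then show thesis using n1 by (intro that[of n]) (auto simp: not_less)
  qed
  have "X j \<omega> = min (X j \<omega>) (\<delta> * (t + c * n))" if "j \<in> {1..n} - {k}" for j
  proof -
    have "\<delta> * (t + c * j) \<le> \<delta> * (t + c * n)"
      using \<delta> c_pos that by (intro mult_left_mono add_left_mono) auto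
    then show ?thesis using others[OF that] by simp
  qed
  then have "S n \<omega> = w (n - k) * X k \<omega> + (\<Sum>j\<in>{1..n} - {k}. w (n - j) * min (X j \<omega>) (\<delta> * (t + c * n)))"
    unfolding S_eq using k by (subst sum.remove[of "{1..n}" k]) auto
  also have "\<dots> < w (n - k) * X k \<omega> + (\<epsilon> * t - (1 - \<epsilon>) * c * n)"
    using no3[of n k] n n1 k by simp
  also have "w (n - k) * X k \<omega> \<le> w (n - k) * ((1 - \<epsilon>) / G * (t + c * k))"
    using no1[of k] k n w_nonneg by (intro mult_left_mono) auto
  \<comment> \<open>Only now may \<open>w (n - k)\<close> be replaced by \<open>G\<close>: the bound
    for \<open>X k\<close> is nonnegative, whereas \<open>X k\<close> itself need not be.\<close>
  also have "\<dots> \<le> G * ((1 - \<epsilon>) / G * (t + c * n))"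
    using w_le_G \<epsilon> G_pos t c_pos k
    by (intro mult_mono mult_left_mono add_left_mono) (auto intro!: mult_nonneg_nonneg add_nonneg_nonneg)
  also have "\<dots> = (1 - \<epsilon>) * (t + c * n)" using G_pos by simp
  finally show False using S_gt by (simp add: algebra_simps)
qed

text \<open>The union bound on a finite horizon. Jump thresholds depend on the jump times alone, so
  the first two sums do not grow with the number of times \<open>n\<close>; the third kind of event
  depends on \<open>n\<close> and on the exempted \<open>k\<close>, which explains the factor
  \<open>real n\<close>.\<close>

lemma upper_bound_finite:
  assumes \<epsilon>: "0 < \<epsilon>" "\<epsilon> < 1" and \<delta>: "\<delta> > 0" and t: "t > 0"
    and bound: "\<And>n k. k \<in> {1..n} \<Longrightarrow>
      prob {\<omega> \<in> space P. \<epsilon> * t - (1 - \<epsilon>) * c * real n \<le> (\<Sum>j\<in>{1..n} - {k}. w (n - j) * min (X j \<omega>) (\<delta> * (t + c * real n)))} \<le> b n"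
  shows "prob {\<omega> \<in> space P. \<exists>n\<le>N. S n \<omega> > t} \<le>
    (\<Sum>k\<in>{1..N}. f ((1 - \<epsilon>) / G * (t + c * real k))) + (\<Sum>k\<in>{1..N}. f (\<delta> * (t + c * real k)))\<^sup>2 +
    (\<Sum>n\<in>{1..N}. real n * b n)"
proof -
  define A1 where "A1 k = {\<omega> \<in> space P. X k \<omega> > (1 - \<epsilon>) / G * (t + c * real k)}" for k :: nat
  define A2 where "A2 i j = {\<omega> \<in> space P. i \<noteq> j \<and> X i \<omega> > \<delta> * (t + c * real i) \<and> X j \<omega> > \<delta> * (t + c * real j)}" for i j :: nat
  define A3 where "A3 n k = {\<omega> \<in> space P. \<epsilon> * t - (1 - \<epsilon>) * c * real n \<le>
      (\<Sum>j\<in>{1..n} - {k}. w (n - j) * min (X j \<omega>) (\<delta> * (t + c * real n)))}" for n k :: nat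
  have A1: "A1 k \<in> events" if "k \<ge> 1" for k using X_meas[OF that] unfolding A1_def by measurable
  have A2: "A2 i j \<in> events" if "i \<ge> 1" "j \<ge> 1" for i j
    using X_meas[OF that(1)] X_meas[OF that(2)] unfolding A2_def by measurable
  have A3: "A3 n k \<in> events" for n k
  proof -
    have [measurable]: "(\<lambda>\<omega>. \<Sum>j\<in>{1..n} - {k}. w (n - j) * min (X j \<omega>) (\<delta> * (t + c * real n))) \<in> borel_measurable P"
      by (intro borel_measurable_sum borel_measurable_times borel_measurable_min X_meas) auto
    show ?thesis unfolding A3_def by measurable
  qed
  define U1 U2 U3 where "U1 = (\<Union>k\<in>{1..N}. A1 k)" and "U2 = (\<Union>i\<in>{1..N}. \<Union>j\<in>{1..N}. A2 i j)"
    and "U3 = (\<Union>n\<in>{1..N}. \<Union>k\<in>{1..n}. A3 n k)"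
  have U_events: "U1 \<in> events" "U2 \<in> events" "U3 \<in> events"
    using A1 A2 A3 by (auto simp: U1_def U2_def U3_def intro!: sets.finite_UN)
  have "{\<omega> \<in> space P. \<exists>n\<le>N. S n \<omega> > t} \<subseteq> U1 \<union> U2 \<union> U3"
  proof
    fix \<omega> assume "\<omega> \<in> {\<omega> \<in> space P. \<exists>n\<le>N. S n \<omega> > t}"
    then obtain n where "\<omega> \<in> space P" "n \<le> N" "S n \<omega> > t" by blast
    with exceeds_decomposition[OF \<epsilon> \<delta> t \<open>S n \<omega> > t\<close> \<open>n \<le> N\<close>] show "\<omega> \<in> U1 \<union> U2 \<union> U3"
      unfolding U1_def U2_def U3_def A1_def A2_def A3_def by blast
  qed
  then have "prob {\<omega> \<in> space P. \<exists>n\<le>N. S n \<omega> > t} \<le> prob (U1 \<union> U2 \<union> U3)"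
    using U_events by (intro finite_measure_mono) auto
  also have "\<dots> \<le> prob U1 + prob U2 + prob U3"
    using measure_Un_le[of "U1 \<union> U2" P U3] measure_Un_le[of U1 P U2] U_events
    by (meson add_right_mono order_trans sets.Un)
  also have "prob U1 \<le> (\<Sum>k\<in>{1..N}. prob (A1 k))"
    unfolding U1_def using A1 by (intro measure_UNION_le) auto
  also have "\<dots> = (\<Sum>k\<in>{1..N}. f ((1 - \<epsilon>) / G * (t + c * real k)))"
    unfolding A1_def by (intro sum.cong refl prob_X_gt) auto
  also have "prob U2 \<le> (\<Sum>i\<in>{1..N}. \<Sum>j\<in>{1..N}. prob (A2 i j))"
    unfolding U2_def using A2
    by (intro order_trans[OF measure_UNION_le sum_mono[OF measure_UNION_le]]) (auto intro!: sets.finite_UN)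
  also have "\<dots> \<le> (\<Sum>i\<in>{1..N}. \<Sum>j\<in>{1..N}. f (\<delta> * (t + c * real i)) * f (\<delta> * (t + c * real j)))"
  proof (intro sum_mono)
    \<comment> \<open>On the diagonal the event is empty owing to its clause
      \<open>i \<noteq> j\<close>; admitting these terms makes the double sum a perfect
      square.\<close>
    fix i j assume "i \<in> {1..N}" "j \<in> {1..N}"
    then show "prob (A2 i j) \<le> f (\<delta> * (t + c * real i)) * f (\<delta> * (t + c * real j))"
      using prob_two_jumps[of i j "\<delta> * (t + c * real i)" "\<delta> * (t + c * real j)"]
      by (cases "i = j") (auto simp: A2_def law.f_nonneg)
  qed
  also have "\<dots> = (\<Sum>k\<in>{1..N}. f (\<delta> * (t + c * real k)))\<^sup>2"
    by (simp add: power2_eq_square sum_product)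
  also have "prob U3 \<le> (\<Sum>n\<in>{1..N}. \<Sum>k\<in>{1..n}. prob (A3 n k))"
    unfolding U3_def using A3
    by (intro order_trans[OF measure_UNION_le sum_mono[OF measure_UNION_le]]) (auto intro!: sets.finite_UN)
  also have "\<dots> \<le> (\<Sum>n\<in>{1..N}. \<Sum>k\<in>{1..n}. b n)"
    unfolding A3_def by (intro sum_mono bound)
  also have "\<dots> = (\<Sum>n\<in>{1..N}. real n * b n)" by simp
  finally show ?thesis by simp
qed

lemma prob_exceeds_le:
  assumes "\<And>N. prob {\<omega> \<in> space P. \<exists>n\<le>N. S n \<omega> > t} \<le> b"
  shows "prob (exceeds t) \<le> b"
proof -
  have "(\<lambda>N. prob {\<omega> \<in> space P. \<exists>n\<le>N. S n \<omega> > t}) \<longlonglongrightarrow> prob (\<Union>N. {\<omega> \<in> space P. \<exists>n\<le>N. S n \<omega> > t})"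
    by (rule finite_Lim_measure_incseq) (auto simp: incseq_def intro: order_trans)
  also have "(\<Union>N. {\<omega> \<in> space P. \<exists>n\<le>N. S n \<omega> > t}) = exceeds t"
    by (auto simp: exceeds_def)
  finally show ?thesis using assms by (intro LIMSEQ_le_const2) auto
qed

lemma upper_bound:
  assumes \<epsilon>: "0 < \<epsilon>" "\<epsilon> < 1"
  obtains \<delta> R where "\<delta> > 0"
    "eventually (\<lambda>t. prob (exceeds t) \<le> law.tail_sum ((1 - \<epsilon>) / G) c t + (law.tail_sum \<delta> c t)\<^sup>2 + R * t powr - (\<alpha> + 1)) at_top"
proof -
  have p: "\<alpha> + 4 > 0" using law.\<alpha>_gt_1 by simp
  obtain \<delta> C u0 where \<delta>: "\<delta> > 0" "C > 0" and bound: "\<And>t n k. t \<ge> u0 \<Longrightarrow> k \<in> {1..n} \<Longrightarrow>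
      prob {\<omega> \<in> space P. \<epsilon> * t - (1 - \<epsilon>) * c * real n \<le> (\<Sum>j\<in>{1..n} - {k}. w (n - j) * min (X j \<omega>) (\<delta> * (t + c * real n)))}
      \<le> C * (t + c * real n) powr - (\<alpha> + 4)"
    by (rule no_big_jump_bound[OF \<epsilon> p]) (rule that)
  define R where "R = C * ((\<Sum>n. 1 / real (Suc n) ^ 2) / c ^ 3)"
  have \<rho>: "(1 - \<epsilon>) / G > 0" using \<epsilon> G_pos by simp
  have "eventually (\<lambda>t. prob (exceeds t) \<le> law.tail_sum ((1 - \<epsilon>) / G) c t + (law.tail_sum \<delta> c t)\<^sup>2 + R * t powr - (\<alpha> + 1)) at_top"
    using eventually_ge_at_top[of u0] eventually_gt_at_top[of 0]
      law.tail_sum_summable[OF \<rho> c_pos] law.tail_sum_summable[OF \<delta>(1) c_pos]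
  proof eventually_elim
    case (elim t)
    show ?case
    proof (rule prob_exceeds_le)
      fix N
      have "prob {\<omega> \<in> space P. \<exists>n\<le>N. S n \<omega> > t} \<le>
          (\<Sum>k\<in>{1..N}. f ((1 - \<epsilon>) / G * (t + c * real k))) + (\<Sum>k\<in>{1..N}. f (\<delta> * (t + c * real k)))\<^sup>2 +
          (\<Sum>n\<in>{1..N}. real n * (C * (t + c * real n) powr - (\<alpha> + 4)))"
        by (rule upper_bound_finite[OF \<epsilon> \<delta>(1) elim(2) bound[OF elim(1)]])
      also have "(\<Sum>k\<in>{1..N}. f ((1 - \<epsilon>) / G * (t + c * real k))) \<le> law.tail_sum ((1 - \<epsilon>) / G) c t"
        by (rule law.sum_f_le_tail_sum[OF elim(3)])
      also have "(\<Sum>k\<in>{1..N}. f (\<delta> * (t + c * real k)))\<^sup>2 \<le> (law.tail_sum \<delta> c t)\<^sup>2"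
        by (intro power_mono law.sum_f_le_tail_sum[OF elim(4)] sum_nonneg law.f_nonneg)
      also have "(\<Sum>n\<in>{1..N}. real n * (C * (t + c * real n) powr - (\<alpha> + 4))) =
          C * (\<Sum>n\<in>{1..N}. real n * (t + c * real n) powr - (\<alpha> + 4))"
        by (simp add: sum_distrib_left mult.left_commute)
      also have "\<dots> \<le> C * ((\<Sum>n. 1 / real (Suc n) ^ 2) / c ^ 3 * t powr - (\<alpha> + 1))"
        using sum_mult_powr_bound[OF c_pos elim(2), of \<alpha> N] law.\<alpha>_gt_1 \<delta> by (intro mult_left_mono) auto
      also have "\<dots> = R * t powr - (\<alpha> + 1)" by (simp add: R_def)
      finally show "prob {\<omega> \<in> space P. \<exists>n\<le>N. S n \<omega> > t} \<le>
          law.tail_sum ((1 - \<epsilon>) / G) c t + (law.tail_sum \<delta> c t)\<^sup>2 + R * t powr - (\<alpha> + 1)" by simp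
    qed
  qed
  with \<delta> that show thesis by blast
qed

section \<open>Lower bound\<close>

text \<open>A weak law in mean, uniform in index sets and weights because the weights attached to a
  given variable change with time. After truncation at \<open>b\<close> the bounded part has a
  second moment of order \<open>card J\<close> and the rest is small in mean. The inequality
  \<open>\<bar>x\<bar> \<le> \<theta> * x\<^sup>2 + 1 / (4 * \<theta>)\<close> converts the second
  moment into a small linear term and a constant.\<close>

lemma expectation_weighted_sum:
  fixes \<eta> :: real
  assumes \<eta>: "\<eta> > 0"
  obtains K where "K \<ge> 0"
    "\<And>J v. finite J \<Longrightarrow> J \<subseteq> {1..} \<Longrightarrow> \<forall>j\<in>J. 0 \<le> v j \<and> v j \<le> G \<Longrightarrow>
      expectation (\<lambda>\<omega>. \<bar>\<Sum>j\<in>J. v j * (X j \<omega> - law.\<mu>)\<bar>) \<le> \<eta> * real (card J) + K"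
proof -
  \<comment> \<open>The truncation error enters twice, through \<open>r\<close> and through the
    shift of the mean, with weight at most \<open>G\<close>: together \<open>\<eta> / 2\<close> per
    index.\<close>
  define \<tau> where "\<tau> = \<eta> / (4 * G)"
  have \<tau>: "\<tau> > 0" using \<eta> G_pos by (simp add: \<tau>_def)
  obtain b where b: "b > 0" and tr: "(LINT x|D. \<bar>x - x * indicator {-b..b} x\<bar>) \<le> \<tau>"
    using law.truncation_error_small[OF \<tau>] by blast
  define h where "h x = x * indicator {-b..b} x" for x :: real
  define \<nu> where "\<nu> = (LINT x|D. h x)"
  define r where "r x = \<bar>x - h x\<bar>" for x :: real
  have h_meas[measurable]: "h \<in> borel_measurable borel" unfolding h_def by measurable
  have r_meas[measurable]: "r \<in> borel_measurable borel" unfolding r_def by measurable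
  have h_le: "\<bar>h x\<bar> \<le> b" for x using b by (auto simp: h_def indicator_def)
  have h_int: "integrable D h"
    by (rule law.integrable_const_bound[of _ b]) (use h_le in auto)
  have r_int: "integrable D r"
    unfolding r_def using law.D_integrable h_int by auto
  have r_tau: "(LINT x|D. r x) \<le> \<tau>" using tr by (simp add: r_def h_def)
  have \<nu>_le: "\<bar>\<nu>\<bar> \<le> b"
  proof -
    have "\<bar>\<nu>\<bar> \<le> (LINT x|D. \<bar>h x\<bar>)" unfolding \<nu>_def by (rule integral_abs_bound)
    also have "\<dots> \<le> b" by (rule law.integral_le_const) (use h_int h_le in auto)
    finally show ?thesis .
  qed
  have \<nu>_\<mu>: "\<bar>\<nu> - law.\<mu>\<bar> \<le> \<tau>"
  proof -
    have "\<nu> - law.\<mu> = (LINT x|D. h x - x)" unfolding \<nu>_def using h_int law.D_integrable by simp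
    also have "\<bar>\<dots>\<bar> \<le> (LINT x|D. \<bar>h x - x\<bar>)" by (rule integral_abs_bound)
    also have "\<dots> = (LINT x|D. r x)" by (simp add: r_def abs_minus_commute)
    finally show ?thesis using r_tau by simp
  qed
  define B where "B = G * (2 * b)"
  have B: "B > 0" using G_pos b by (simp add: B_def)
  \<comment> \<open>With this choice \<open>\<theta> * (card J * B\<^sup>2)\<close> is the other
    half of the allowance, \<open>\<eta> / 2\<close> per index.\<close>
  define \<theta> where "\<theta> = \<eta> / (2 * B\<^sup>2)"
  have \<theta>: "\<theta> > 0" using \<eta> B by (simp add: \<theta>_def)
  have quad: "\<bar>x\<bar> \<le> \<theta> * x\<^sup>2 + 1 / (4 * \<theta>)" for x :: real
  proof -
    have "0 \<le> \<theta> * (\<bar>x\<bar> - 1 / (2 * \<theta>))\<^sup>2" using \<theta> by simp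
    also have "\<dots> = \<theta> * x\<^sup>2 + 1 / (4 * \<theta>) - \<bar>x\<bar>" using \<theta> by (simp add: power2_eq_square field_simps)
    finally show ?thesis by simp
  qed
  have "expectation (\<lambda>\<omega>. \<bar>\<Sum>j\<in>J. v j * (X j \<omega> - law.\<mu>)\<bar>) \<le> \<eta> * real (card J) + 1 / (4 * \<theta>)"
    if J: "finite J" "J \<subseteq> {1..}" and v: "\<forall>j\<in>J. 0 \<le> v j \<and> v j \<le> G" for J v
  proof -
    define Z where "Z j \<omega> = v j * (h (X j \<omega>) - \<nu>)" for j \<omega>
    define V where "V \<omega> = (\<Sum>j\<in>J. Z j \<omega>)" for \<omega>
    have J1: "j \<ge> 1" if "j \<in> J" for j using J that by auto
    have Z_indep: "indep_vars (\<lambda>_. borel) Z J"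
      unfolding Z_def by (rule indep_vars_compose2[OF indep_vars_subset[OF indep J(2)]]) measurable
    have Z_bound: "\<bar>Z j \<omega>\<bar> \<le> B" if "j \<in> J" for j \<omega>
    proof -
      have "\<bar>h (X j \<omega>) - \<nu>\<bar> \<le> 2 * b" using h_le[of "X j \<omega>"] \<nu>_le by linarith
      then show ?thesis unfolding Z_def B_def abs_mult using bspec[OF v that] by (intro mult_mono) auto
    qed
    have hX_int: "integrable P (\<lambda>\<omega>. h (X j \<omega>))" if "j \<in> J" for j
      by (rule integrable_X[OF J1[OF that] h_meas h_int])
    have rX_int: "integrable P (\<lambda>\<omega>. r (X j \<omega>))" if "j \<in> J" for j
      by (rule integrable_X[OF J1[OF that] r_meas r_int])
    have X_int: "integrable P (X j)" if "j \<in> J" for j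
      using integrable_X[OF J1[OF that] _ law.D_integrable] by simp
    have Z_mean: "expectation (Z j) = 0" if "j \<in> J" for j
      unfolding Z_def using hX_int[OF that] expectation_X[OF J1[OF that] h_meas] prob_space
      by (simp add: \<nu>_def)
    have V2: "integrable P (\<lambda>\<omega>. (V \<omega>)\<^sup>2)" "expectation (\<lambda>\<omega>. (V \<omega>)\<^sup>2) \<le> card J * B\<^sup>2"
      using second_moment_indep_sum[OF J(1) Z_indep Z_bound Z_mean] by (auto simp: V_def)
    have pw: "\<bar>\<Sum>j\<in>J. v j * (X j \<omega> - law.\<mu>)\<bar> \<le> (\<theta> * (V \<omega>)\<^sup>2 + 1 / (4 * \<theta>)) + (\<Sum>j\<in>J. G * (r (X j \<omega>) + \<tau>))" for \<omega>
    proof -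
      have "(\<Sum>j\<in>J. v j * (X j \<omega> - law.\<mu>)) = V \<omega> + (\<Sum>j\<in>J. v j * ((X j \<omega> - h (X j \<omega>)) + (\<nu> - law.\<mu>)))"
        unfolding V_def Z_def sum.distrib [symmetric] by (intro sum.cong) (auto simp: algebra_simps)
      also have "\<bar>\<dots>\<bar> \<le> \<bar>V \<omega>\<bar> + (\<Sum>j\<in>J. \<bar>v j * ((X j \<omega> - h (X j \<omega>)) + (\<nu> - law.\<mu>))\<bar>)"
        by (intro order_trans[OF abs_triangle_ineq] add_left_mono sum_abs)
      also have "\<dots> \<le> (\<theta> * (V \<omega>)\<^sup>2 + 1 / (4 * \<theta>)) + (\<Sum>j\<in>J. G * (r (X j \<omega>) + \<tau>))"
      proof (intro add_mono quad sum_mono)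
        fix j assume "j \<in> J"
        have "\<bar>(X j \<omega> - h (X j \<omega>)) + (\<nu> - law.\<mu>)\<bar> \<le> r (X j \<omega>) + \<tau>"
          using \<nu>_\<mu> unfolding r_def by linarith
        then show "\<bar>v j * ((X j \<omega> - h (X j \<omega>)) + (\<nu> - law.\<mu>))\<bar> \<le> G * (r (X j \<omega>) + \<tau>)"
          unfolding abs_mult using bspec[OF v \<open>j \<in> J\<close>] by (intro mult_mono) auto
      qed
      finally show ?thesis .
    qed
    have i1: "integrable P (\<lambda>\<omega>. \<theta> * (V \<omega>)\<^sup>2 + 1 / (4 * \<theta>))" using V2(1) by auto
    have i2: "integrable P (\<lambda>\<omega>. \<Sum>j\<in>J. G * (r (X j \<omega>) + \<tau>))" using rX_int by auto
    have "expectation (\<lambda>\<omega>. \<bar>\<Sum>j\<in>J. v j * (X j \<omega> - law.\<mu>)\<bar>) \<le>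
        expectation (\<lambda>\<omega>. (\<theta> * (V \<omega>)\<^sup>2 + 1 / (4 * \<theta>)) + (\<Sum>j\<in>J. G * (r (X j \<omega>) + \<tau>)))"
      by (rule integral_mono[OF _ Bochner_Integration.integrable_add[OF i1 i2] pw]) (use X_int in auto)
    also have "\<dots> = expectation (\<lambda>\<omega>. \<theta> * (V \<omega>)\<^sup>2 + 1 / (4 * \<theta>)) + expectation (\<lambda>\<omega>. \<Sum>j\<in>J. G * (r (X j \<omega>) + \<tau>))"
      by (rule Bochner_Integration.integral_add[OF i1 i2])
    also have "expectation (\<lambda>\<omega>. \<theta> * (V \<omega>)\<^sup>2 + 1 / (4 * \<theta>)) = \<theta> * expectation (\<lambda>\<omega>. (V \<omega>)\<^sup>2) + 1 / (4 * \<theta>)"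
      using V2(1) prob_space by simp
    also have "\<dots> \<le> \<theta> * (card J * B\<^sup>2) + 1 / (4 * \<theta>)"
      using V2(2) \<theta> by (intro add_right_mono mult_left_mono) auto
    also have "\<theta> * (card J * B\<^sup>2) = \<eta> / 2 * real (card J)" using B by (simp add: \<theta>_def)
    also have "expectation (\<lambda>\<omega>. \<Sum>j\<in>J. G * (r (X j \<omega>) + \<tau>)) = (\<Sum>j\<in>J. expectation (\<lambda>\<omega>. G * (r (X j \<omega>) + \<tau>)))"
      using rX_int by (intro Bochner_Integration.integral_sum) auto
    also have "\<dots> \<le> (\<Sum>j\<in>J. G * (\<tau> + \<tau>))"
    proof (rule sum_mono)
      fix j assume j: "j \<in> J"
      have "expectation (\<lambda>\<omega>. G * (r (X j \<omega>) + \<tau>)) = G * ((LINT x|D. r x) + \<tau>)"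
        using rX_int[OF j] expectation_X[OF J1[OF j] r_meas] prob_space by simp
      then show "expectation (\<lambda>\<omega>. G * (r (X j \<omega>) + \<tau>)) \<le> G * (\<tau> + \<tau>)"
        using r_tau G_pos by simp
    qed
    also have "\<dots> = \<eta> / 2 * real (card J)" using G_pos by (simp add: \<tau>_def)
    finally show ?thesis by (simp add: algebra_simps)
  qed
  then show thesis using that[of "1 / (4 * \<theta>)"] \<theta> by simp
qed

text \<open>A jump above \<open>(1 + \<epsilon>) / w m * (t + c * k)\<close> at time \<open>k\<close> lifts the walk above \<open>t\<close> at time
  \<open>k + m\<close>, unless the remaining summands fall below the level considered here.\<close>
lemma rest_rarely_small:
  assumes \<epsilon>: "0 < \<epsilon>" and \<eta>: "\<eta> > 0"
  obtains t0 where "t0 > 0"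
    "\<And>t k. t \<ge> t0 \<Longrightarrow> k \<ge> 1 \<Longrightarrow>
      prob {\<omega> \<in> space P. (\<Sum>j\<in>{1..k+m} - {k}. w (k + m - j) * X j \<omega>) > - (\<epsilon> * t + (1 + \<epsilon>) * c * real k)} \<ge> 1 - \<eta>"
proof -
  \<comment> \<open>Markov's inequality will divide by \<open>\<epsilon> / 2 * (t + c * k)\<close>,
    and \<open>\<eta>' * k\<close> is \<eta> times the part of this that grows with
    \<open>k\<close>.\<close>
  define \<eta>' where "\<eta>' = \<eta> * \<epsilon> * c / 2"
  have \<eta>': "\<eta>' > 0" using \<eta> \<epsilon> c_pos by (simp add: \<eta>'_def)
  obtain K where K: "K \<ge> 0" and l1: "\<And>J v. finite J \<Longrightarrow> J \<subseteq> {1..} \<Longrightarrow> \<forall>j\<in>J. 0 \<le> v j \<and> v j \<le> G \<Longrightarrow>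
      expectation (\<lambda>\<omega>. \<bar>\<Sum>j\<in>J. v j * (X j \<omega> - law.\<mu>)\<bar>) \<le> \<eta>' * real (card J) + K"
    by (rule expectation_weighted_sum[OF \<eta>']) (rule that)
  obtain K0 where K0: "K0 \<ge> 0" "\<And>n. \<bar>(\<Sum>i<n. w i) - w_inf * real n\<bar> \<le> (\<epsilon> / 2 * w_inf) * real n + K0"
    using partial_sum_deviation[OF w_lim, of "\<epsilon> / 2 * w_inf"] \<epsilon> w_inf_pos by auto
  define C1 where "C1 = (1 + \<epsilon> / 2) * c * real m - law.\<mu> * K0"
  \<comment> \<open>For large \<open>t\<close> the term \<open>\<epsilon> * t\<close> absorbs what
    does not grow with \<open>k\<close>: the constant \<open>C1\<close> with the drift of
    \<open>m\<close> further steps, and \<open>\<eta>' * m + K\<close> from the weak law.\<close>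
  define t0 where "t0 = max 1 (max (2 * C1 / \<epsilon>) (2 * (\<eta>' * m + K) / (\<eta> * \<epsilon>)))"
  have "prob {\<omega> \<in> space P. (\<Sum>j\<in>{1..k+m} - {k}. w (k + m - j) * X j \<omega>) > - (\<epsilon> * t + (1 + \<epsilon>) * c * real k)} \<ge> 1 - \<eta>"
    if t: "t \<ge> t0" and k: "k \<ge> 1" for t k
  proof -
    define J where "J = {1..k+m} - {k}"
    define W where "W \<omega> = (\<Sum>j\<in>J. w (k + m - j) * X j \<omega>)" for \<omega>
    define V where "V \<omega> = (\<Sum>j\<in>J. w (k + m - j) * (X j \<omega> - law.\<mu>))" for \<omega>
    define u where "u = t + c * real k"
    have t_ge: "t \<ge> 1" "t \<ge> 2 * C1 / \<epsilon>" "t \<ge> 2 * (\<eta>' * m + K) / (\<eta> * \<epsilon>)" using t by (auto simp: t0_def)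
    have t_ge': "C1 \<le> \<epsilon> / 2 * t" "\<eta>' * m + K \<le> \<eta> * \<epsilon> / 2 * t"
      using t_ge \<epsilon> \<eta> by (auto simp: field_simps)
    have u: "u > 0" using t_ge c_pos by (simp add: u_def add_pos_nonneg)
    have X_int: "integrable P (X j)" if "j \<in> J" for j
    proof -
      have "j \<ge> 1" using that by (simp add: J_def)
      from integrable_X[OF this _ law.D_integrable] show ?thesis by simp
    qed
    have V_int: "integrable P V" unfolding V_def[abs_def] by (intro Bochner_Integration.integrable_sum integrable_mult_right Bochner_Integration.integrable_diff X_int integrable_const)
    have W_meas: "W \<in> borel_measurable P"
      unfolding W_def[abs_def] by (intro borel_measurable_sum borel_measurable_times X_meas) (auto simp: J_def)
    have "(\<Sum>j\<in>J. w (k + m - j)) \<le> (\<Sum>j\<in>{1..k+m}. w (k + m - j))"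
      unfolding J_def by (rule sum_mono2) (auto simp: w_nonneg)
    also have "\<dots> = (\<Sum>i<k+m. w i)" using weighted_sum_reindex[of w "\<lambda>_. 1" "k + m"] by simp
    also have "\<dots> \<le> w_inf * real (k + m) + (\<epsilon> / 2 * w_inf * real (k + m) + K0)"
      using K0(2)[of "k + m"] by linarith
    also have "\<dots> = (1 + \<epsilon> / 2) * w_inf * real (k + m) + K0" by (simp add: algebra_simps)
    finally have "- law.\<mu> * (\<Sum>j\<in>J. w (k + m - j)) \<le> - law.\<mu> * ((1 + \<epsilon> / 2) * w_inf * real (k + m) + K0)"
      using mean_neg by (intro mult_left_mono) auto
    also have "\<dots> = (1 + \<epsilon> / 2) * c * real k + C1"
      by (simp add: c_def C1_def field_simps)
    finally have Q: "- law.\<mu> * (\<Sum>j\<in>J. w (k + m - j)) \<le> (1 + \<epsilon> / 2) * c * real k + C1" .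
    have W_V: "W \<omega> = V \<omega> + law.\<mu> * (\<Sum>j\<in>J. w (k + m - j))" for \<omega>
      by (simp add: W_def V_def right_diff_distrib sum_subtractf sum_distrib_left mult.commute)
    \<comment> \<open>The mean of \<open>W\<close> is at least
      \<open>- ((1 + \<epsilon> / 2) * c * k + C1)\<close>, so a fall to the level forces the
      centred sum \<open>V\<close> down by \<open>\<epsilon> / 2 * u\<close>.\<close>
    have "{\<omega> \<in> space P. \<not> W \<omega> > - (\<epsilon> * t + (1 + \<epsilon>) * c * real k)} \<subseteq> {\<omega> \<in> space P. \<epsilon> / 2 * u \<le> \<bar>V \<omega>\<bar>}"
    proof safe
      fix \<omega> assume "\<not> W \<omega> > - (\<epsilon> * t + (1 + \<epsilon>) * c * real k)"
      then have "- V \<omega> \<ge> \<epsilon> * t + (1 + \<epsilon>) * c * real k - ((1 + \<epsilon> / 2) * c * real k + C1)"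
        using Q unfolding W_V by linarith
      also have "\<epsilon> * t + (1 + \<epsilon>) * c * real k - ((1 + \<epsilon> / 2) * c * real k + C1) = \<epsilon> / 2 * u + (\<epsilon> / 2 * t - C1)"
        by (simp add: u_def algebra_simps)
      finally show "\<epsilon> / 2 * u \<le> \<bar>V \<omega>\<bar>" using t_ge'(1) by linarith
    qed
    then have "prob {\<omega> \<in> space P. \<not> W \<omega> > - (\<epsilon> * t + (1 + \<epsilon>) * c * real k)} \<le> prob {\<omega> \<in> space P. \<epsilon> / 2 * u \<le> \<bar>V \<omega>\<bar>}"
      using borel_measurable_integrable[OF V_int] by (intro finite_measure_mono) measurable
    also have "\<dots> \<le> expectation (\<lambda>\<omega>. \<bar>V \<omega>\<bar>) / (\<epsilon> / 2 * u)"
      using V_int \<epsilon> u by (intro integral_Markov_inequality_measure[where A = "{}"]) auto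
    also have "\<dots> \<le> (\<eta>' * real (card J) + K) / (\<epsilon> / 2 * u)"
      unfolding V_def using \<epsilon> u w_nonneg w_le_G by (intro divide_right_mono l1) (auto simp: J_def)
    also have "\<dots> \<le> \<eta>"
    proof -
      have "card J \<le> card {1..k+m}" unfolding J_def by (intro card_mono) auto
      then have "\<eta>' * real (card J) + K \<le> \<eta>' * (real k + real m) + K" using \<eta>' by simp
      also have "\<dots> \<le> \<eta>' * real k + \<eta> * \<epsilon> / 2 * t" using t_ge'(2) by (simp add: algebra_simps)
      also have "\<dots> = \<eta> * (\<epsilon> / 2 * u)" by (simp add: \<eta>'_def u_def algebra_simps)
      finally show ?thesis using \<epsilon> u by (simp add: divide_le_eq)
    qed
    finally have "prob {\<omega> \<in> space P. \<not> W \<omega> > - (\<epsilon> * t + (1 + \<epsilon>) * c * real k)} \<le> \<eta>" .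
    moreover have "prob {\<omega> \<in> space P. \<not> W \<omega> > - (\<epsilon> * t + (1 + \<epsilon>) * c * real k)} =
        1 - prob {\<omega> \<in> space P. W \<omega> > - (\<epsilon> * t + (1 + \<epsilon>) * c * real k)}"
      using W_meas by (intro prob_neg) measurable
    ultimately show ?thesis by (simp add: W_def J_def)
  qed
  moreover have "t0 > 0" by (simp add: t0_def)
  ultimately show thesis using that by blast
qed

text \<open>\<open>A k\<close> asks for a jump at \<open>k\<close> and a well-behaved rest; these
  are independent, which yields the factor \<open>1 - \<eta>\<close>. Different \<open>A k\<close>
  share variables, so Bonferroni's inequality is used with the bare jump events
  \<open>B k\<close>.\<close>

lemma lower_bound_finite:
  assumes \<epsilon>: "0 < \<epsilon>" and wm: "w m > 0" and t: "t > 0"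
    and rest: "\<And>k. k \<ge> 1 \<Longrightarrow>
      prob {\<omega> \<in> space P. (\<Sum>j\<in>{1..k+m} - {k}. w (k + m - j) * X j \<omega>) > - (\<epsilon> * t + (1 + \<epsilon>) * c * real k)} \<ge> 1 - \<eta>"
  shows "prob (exceeds t) \<ge> (1 - \<eta>) * (\<Sum>k\<in>{1..N}. f ((1 + \<epsilon>) / w m * (t + c * real k)))
    - (\<Sum>k\<in>{1..N}. f ((1 + \<epsilon>) / w m * (t + c * real k)))\<^sup>2"
proof -
  define r where "r k = (1 + \<epsilon>) / w m * (t + c * real k)" for k :: nat
  define W where "W k \<omega> = (\<Sum>j\<in>{1..k+m} - {k}. w (k + m - j) * X j \<omega>)" for k \<omega>
  define A where "A k = {\<omega> \<in> space P. X k \<omega> > r k \<and> W k \<omega> > - (\<epsilon> * t + (1 + \<epsilon>) * c * real k)}" for k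
  define B where "B k = {\<omega> \<in> space P. X k \<omega> > r k}" for k
  have W_meas [measurable]: "W k \<in> borel_measurable P" for k
    unfolding W_def[abs_def] by (intro borel_measurable_sum borel_measurable_times X_meas) auto
  have A_events: "A k \<in> events" if "k \<ge> 1" for k using X_meas[OF that] unfolding A_def by measurable
  have B_events: "B k \<in> events" if "k \<ge> 1" for k using X_meas[OF that] unfolding B_def by measurable
  have prob_B: "prob (B k) = f (r k)" if "k \<ge> 1" for k unfolding B_def by (rule prob_X_gt[OF that])
  have prob_A: "prob (A k) \<ge> (1 - \<eta>) * f (r k)" if "k \<ge> 1" for k
  proof -
    have "prob (A k) = f (r k) * prob {\<omega> \<in> space P. W k \<omega> > - (\<epsilon> * t + (1 + \<epsilon>) * c * real k)}"
      unfolding A_def W_def by (rule prob_X_and_sum) (use that in auto)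
    also have "\<dots> \<ge> f (r k) * (1 - \<eta>)"
      unfolding W_def by (intro mult_left_mono rest that law.f_nonneg)
    finally show ?thesis by (simp add: mult.commute)
  qed
  have "(\<Union>k\<in>{1..N}. A k) \<subseteq> exceeds t"
  proof safe
    fix k \<omega> assume k: "k \<in> {1..N}" and A: "\<omega> \<in> A k"
    have "S (k + m) \<omega> = w m * X k \<omega> + W k \<omega>"
      unfolding S_eq W_def using k by (subst sum.remove[of "{1..k+m}" k]) auto
    moreover have "w m * X k \<omega> > (1 + \<epsilon>) * (t + c * real k)"
      using A wm by (simp add: A_def r_def field_simps)
    ultimately have "S (k + m) \<omega> > (1 + \<epsilon>) * (t + c * real k) - (\<epsilon> * t + (1 + \<epsilon>) * c * real k)"
      using A by (simp add: A_def)
    also have "(1 + \<epsilon>) * (t + c * real k) - (\<epsilon> * t + (1 + \<epsilon>) * c * real k) = t" by (simp add: algebra_simps)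
    finally show "\<omega> \<in> exceeds t" using A by (auto simp: exceeds_def A_def)
  qed
  then have "prob (\<Union>k\<in>{1..N}. A k) \<le> prob (exceeds t)"
    by (intro finite_measure_mono) auto
  moreover have "prob (\<Union>k\<in>{1..N}. A k) \<ge> (\<Sum>k\<in>{1..N}. prob (A k)) - (\<Sum>k\<in>{1..N}. prob (B k))\<^sup>2"
  proof (rule bonferroni_lower_bound)
    fix i j assume ij: "i \<in> {1..N}" "j \<in> {1..N}" "i \<noteq> j"
    have "B i \<inter> B j = {\<omega> \<in> space P. X i \<omega> > r i \<and> X j \<omega> > r j}" by (auto simp: B_def)
    then show "prob (B i \<inter> B j) = prob (B i) * prob (B j)"
      using prob_two_jumps[of i j] ij prob_B by simp
  qed (use A_events B_events in \<open>auto simp: A_def B_def\<close>)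
  moreover have "(\<Sum>k\<in>{1..N}. prob (B k)) = (\<Sum>k\<in>{1..N}. f (r k))"
    by (intro sum.cong refl prob_B) auto
  moreover have "(\<Sum>k\<in>{1..N}. prob (A k)) \<ge> (1 - \<eta>) * (\<Sum>k\<in>{1..N}. f (r k))"
    unfolding sum_distrib_left by (intro sum_mono prob_A) auto
  ultimately show ?thesis by (simp add: r_def)
qed

lemma lower_bound:
  assumes \<epsilon>: "0 < \<epsilon>" and \<eta>: "\<eta> > 0" and wm: "w m > 0"
  shows "eventually (\<lambda>t. prob (exceeds t) \<ge> (1 - \<eta>) * law.tail_sum ((1 + \<epsilon>) / w m) c t
    - (law.tail_sum ((1 + \<epsilon>) / w m) c t)\<^sup>2) at_top"
proof -
  obtain t0 where t0: "t0 > 0" and rest: "\<And>t k. t \<ge> t0 \<Longrightarrow> k \<ge> 1 \<Longrightarrow>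
      prob {\<omega> \<in> space P. (\<Sum>j\<in>{1..k+m} - {k}. w (k + m - j) * X j \<omega>) > - (\<epsilon> * t + (1 + \<epsilon>) * c * real k)} \<ge> 1 - \<eta>"
    by (rule rest_rarely_small[OF \<epsilon> \<eta>, of m]) (rule that)
  have r: "(1 + \<epsilon>) / w m > 0" using \<epsilon> wm by simp
  show ?thesis
    using eventually_ge_at_top[of t0] law.tail_sum_summable[OF r c_pos]
  proof eventually_elim
    case (elim t)
    \<comment> \<open>Because of the subtracted square the finite bound need not increase with
      \<open>N\<close>, so it is passed to the limit as a whole.\<close>
    note lim = law.sum_f_tendsto_tail_sum[OF elim(2)]
    have "t > 0" using elim t0 by simp
    note fin = lower_bound_finite[OF \<epsilon> wm this rest[OF elim(1)]]
    show ?case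
      by (rule LIMSEQ_le_const2[OF tendsto_diff[OF tendsto_mult[OF tendsto_const lim] tendsto_power[OF lim]]])
         (use fin in blast)
  qed
qed

section \<open>Combination of the two bounds\<close>

lemma tail_sum_square_negligible:
  assumes "r > 0"
  shows "((\<lambda>t. (law.tail_sum r c t)\<^sup>2 / (t * f t)) \<longlongrightarrow> 0) at_top"
proof -
  have "((\<lambda>t. (law.tail_sum r c t / (t * f t))\<^sup>2 * (t * f t)) \<longlongrightarrow> (r powr - \<alpha> / (c * (\<alpha> - 1)))\<^sup>2 * 0) at_top"
    by (intro tendsto_mult tendsto_power law.tail_sum_asymp[OF assms c_pos] law.mult_f_tendsto_0)
  moreover have "\<forall>\<^sub>F t in at_top. (law.tail_sum r c t / (t * f t))\<^sup>2 * (t * f t) = (law.tail_sum r c t)\<^sup>2 / (t * f t)"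
    using eventually_gt_at_top[of 0]
    by eventually_elim (use law.f_pos in \<open>simp add: power2_eq_square\<close>)
  ultimately show ?thesis by (auto dest: Lim_transform_eventually)
qed

text \<open>For each target \<open>a\<close> on either side of the limit, \<epsilon> is fixed before
  \<open>t\<close> tends to infinity, so no uniformity in \<epsilon> is required. Suitable
  \<epsilon> exist because the constants of both bounds are continuous at
  \<open>\<epsilon> = 0\<close> and agree there.\<close>

lemma prob_exceeds_asymp:
  "((\<lambda>t. prob (exceeds t) / (t * f t)) \<longlongrightarrow> G powr \<alpha> / (c * (\<alpha> - 1))) at_top"
proof (rule order_tendstoI)
  fix a assume a: "a > G powr \<alpha> / (c * (\<alpha> - 1))"
  have "((\<lambda>\<epsilon>. ((1 - \<epsilon>) / G) powr - \<alpha> / (c * (\<alpha> - 1))) \<longlongrightarrow> ((1 - 0) / G) powr - \<alpha> / (c * (\<alpha> - 1))) (at_right 0)"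
    using G_pos by (intro tendsto_intros) (use c_pos law.\<alpha>_gt_1 in auto)
  moreover have "((1 - 0) / G) powr - \<alpha> / (c * (\<alpha> - 1)) = G powr \<alpha> / (c * (\<alpha> - 1))"
    using G_pos by (simp add: powr_divide powr_minus)
  ultimately have "((\<lambda>\<epsilon>. ((1 - \<epsilon>) / G) powr - \<alpha> / (c * (\<alpha> - 1))) \<longlongrightarrow> G powr \<alpha> / (c * (\<alpha> - 1))) (at_right 0)"
    by (simp only:)
  then have "eventually (\<lambda>\<epsilon>. ((1 - \<epsilon>) / G) powr - \<alpha> / (c * (\<alpha> - 1)) < a) (at_right 0)"
    using a by (rule order_tendstoD)
  then have "eventually (\<lambda>\<epsilon>. ((1 - \<epsilon>) / G) powr - \<alpha> / (c * (\<alpha> - 1)) < a \<and> \<epsilon> \<in> {0<..<1}) (at_right 0)"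
    by (intro eventually_conj eventually_at_right_real) auto
  then obtain \<epsilon> where \<epsilon>: "0 < \<epsilon>" "\<epsilon> < 1" and lt: "((1 - \<epsilon>) / G) powr - \<alpha> / (c * (\<alpha> - 1)) < a"
    using eventually_happens'[of "at_right (0::real)"] by auto
  obtain \<delta> R where \<delta>: "\<delta> > 0" and ub:
    "eventually (\<lambda>t. prob (exceeds t) \<le> law.tail_sum ((1 - \<epsilon>) / G) c t + (law.tail_sum \<delta> c t)\<^sup>2 + R * t powr - (\<alpha> + 1)) at_top"
    by (rule upper_bound[OF \<epsilon>]) (rule that)
  have \<rho>: "(1 - \<epsilon>) / G > 0" using \<epsilon> G_pos by simp
  have "((\<lambda>t. law.tail_sum ((1 - \<epsilon>) / G) c t / (t * f t) + (law.tail_sum \<delta> c t)\<^sup>2 / (t * f t) + R * (t powr - (\<alpha> + 1) / (t * f t)))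
      \<longlongrightarrow> ((1 - \<epsilon>) / G) powr - \<alpha> / (c * (\<alpha> - 1)) + 0 + R * 0) at_top"
    by (intro tendsto_add tendsto_mult tendsto_const law.tail_sum_asymp[OF \<rho> c_pos]
        tail_sum_square_negligible[OF \<delta>] law.powr_negligible)
  then have "eventually (\<lambda>t. law.tail_sum ((1 - \<epsilon>) / G) c t / (t * f t) + (law.tail_sum \<delta> c t)\<^sup>2 / (t * f t) + R * (t powr - (\<alpha> + 1) / (t * f t)) < a) at_top"
    using lt by (intro order_tendstoD) auto
  then show "eventually (\<lambda>t. prob (exceeds t) / (t * f t) < a) at_top"
    using ub eventually_gt_at_top[of 0]
  proof eventually_elim
    case (elim t)
    have "prob (exceeds t) / (t * f t) \<le>
        (law.tail_sum ((1 - \<epsilon>) / G) c t + (law.tail_sum \<delta> c t)\<^sup>2 + R * t powr - (\<alpha> + 1)) / (t * f t)"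
      using elim law.f_nonneg by (intro divide_right_mono) auto
    with elim(1) show ?case by (simp add: add_divide_distrib)
  qed
next
  fix a assume a: "a < G powr \<alpha> / (c * (\<alpha> - 1))"
  \<comment> \<open>The factor \<open>1 - \<epsilon>\<close> in front stems from taking
    \<open>\<eta> = \<epsilon>\<close> in \<open>lower_bound\<close>, the one in the denominator
    from a weight \<open>w m > G * (1 - \<epsilon>)\<close>.\<close>
  have "((\<lambda>\<epsilon>. (1 - \<epsilon>) * ((1 + \<epsilon>) / (G * (1 - \<epsilon>))) powr - \<alpha> / (c * (\<alpha> - 1))) \<longlongrightarrow>
      (1 - 0) * ((1 + 0) / (G * (1 - 0))) powr - \<alpha> / (c * (\<alpha> - 1))) (at_right 0)"
    using G_pos by (intro tendsto_intros) (use c_pos law.\<alpha>_gt_1 in auto)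
  moreover have "(1 - 0) * ((1 + 0) / (G * (1 - 0))) powr - \<alpha> / (c * (\<alpha> - 1)) = G powr \<alpha> / (c * (\<alpha> - 1))"
    using G_pos by (simp add: powr_divide powr_minus)
  ultimately have "((\<lambda>\<epsilon>. (1 - \<epsilon>) * ((1 + \<epsilon>) / (G * (1 - \<epsilon>))) powr - \<alpha> / (c * (\<alpha> - 1))) \<longlongrightarrow>
      G powr \<alpha> / (c * (\<alpha> - 1))) (at_right 0)"
    by (simp only:)
  then have "eventually (\<lambda>\<epsilon>. (1 - \<epsilon>) * ((1 + \<epsilon>) / (G * (1 - \<epsilon>))) powr - \<alpha> / (c * (\<alpha> - 1)) > a) (at_right 0)"
    using a by (rule order_tendstoD)
  then have "eventually (\<lambda>\<epsilon>. (1 - \<epsilon>) * ((1 + \<epsilon>) / (G * (1 - \<epsilon>))) powr - \<alpha> / (c * (\<alpha> - 1)) > a \<and> \<epsilon> \<in> {0<..<1}) (at_right 0)"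
    by (intro eventually_conj eventually_at_right_real) auto
  then obtain \<epsilon> where \<epsilon>: "0 < \<epsilon>" "\<epsilon> < 1"
    and gt: "(1 - \<epsilon>) * ((1 + \<epsilon>) / (G * (1 - \<epsilon>))) powr - \<alpha> / (c * (\<alpha> - 1)) > a"
    using eventually_happens'[of "at_right (0::real)"] by auto
  have "G * (1 - \<epsilon>) < G" using G_pos \<epsilon> by simp
  then have "G * (1 - \<epsilon>) < (SUP i. w i)" by (simp only: G_def [symmetric])
  then obtain m where m: "G * (1 - \<epsilon>) < w m"
    using less_cSUP_iff[OF _ w_bdd, of "G * (1 - \<epsilon>)"] by auto
  have wm: "w m > 0" using m mult_pos_pos[OF G_pos, of "1 - \<epsilon>"] \<epsilon> by linarith
  define r where "r = (1 + \<epsilon>) / w m"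
  have r: "r > 0" using wm \<epsilon> by (simp add: r_def)
  have "r \<le> (1 + \<epsilon>) / (G * (1 - \<epsilon>))"
    unfolding r_def using m G_pos wm \<epsilon> by (intro divide_left_mono) auto
  then have "((1 + \<epsilon>) / (G * (1 - \<epsilon>))) powr - \<alpha> \<le> r powr - \<alpha>"
    using r law.\<alpha>_gt_1 by (intro powr_mono2') auto
  then have "(1 - \<epsilon>) * ((1 + \<epsilon>) / (G * (1 - \<epsilon>))) powr - \<alpha> / (c * (\<alpha> - 1)) \<le> (1 - \<epsilon>) * r powr - \<alpha> / (c * (\<alpha> - 1))"
    using \<epsilon> c_pos law.\<alpha>_gt_1 by (intro divide_right_mono mult_left_mono) auto
  with gt have lt: "a < (1 - \<epsilon>) * (r powr - \<alpha> / (c * (\<alpha> - 1))) - 0" by simp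
  have "((\<lambda>t. (1 - \<epsilon>) * (law.tail_sum r c t / (t * f t)) - (law.tail_sum r c t)\<^sup>2 / (t * f t))
      \<longlongrightarrow> (1 - \<epsilon>) * (r powr - \<alpha> / (c * (\<alpha> - 1))) - 0) at_top"
    by (intro tendsto_diff tendsto_mult tendsto_const law.tail_sum_asymp[OF r c_pos] tail_sum_square_negligible[OF r])
  then have "eventually (\<lambda>t. a < (1 - \<epsilon>) * (law.tail_sum r c t / (t * f t)) - (law.tail_sum r c t)\<^sup>2 / (t * f t)) at_top"
    using lt by (rule order_tendstoD)
  then show "eventually (\<lambda>t. a < prob (exceeds t) / (t * f t)) at_top"
    using lower_bound[OF \<epsilon>(1) \<epsilon>(1) wm] eventually_gt_at_top[of 0]
  proof eventually_elim
    case (elim t)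
    have "((1 - \<epsilon>) * law.tail_sum r c t - (law.tail_sum r c t)\<^sup>2) / (t * f t) \<le> prob (exceeds t) / (t * f t)"
      using elim law.f_nonneg unfolding r_def by (intro divide_right_mono) auto
    with elim(1) show ?case by (simp add: diff_divide_distrib)
  qed
qed

end

section \<open>Transfer to the \<open>(g,F)\<close>-process\<close>

theorem theorem2p1p3:
  fixes g F :: "real \<Rightarrow> real" and g_inf \<alpha> :: real
    and P :: "'a measure" and X :: "nat \<Rightarrow> 'a \<Rightarrow> real"
  assumes "real_analytic_on g {-1<..<1}"
    and "\<And>n. taylor_coeff g n \<ge> 0"
    and "taylor_coeff g \<longlonglongrightarrow> g_inf" and "g_inf > 0"
    and "distribution_function F"
    and "has_finite_mean F" and "mean F < 0"
    and "regularly_varying (tail F) (- \<alpha>)" and "- \<alpha> < - 1"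
    and "prob_space P" and "iid_with_cdf P X F"
  shows "asymp_equiv (\<lambda>t. measure P {\<omega> \<in> space P. gF_max g X \<omega> > ereal t}) at_top
           (\<lambda>t. (SUP i. taylor_coeff g i) powr \<alpha> / (- mean F * g_inf) * (t * tail F t / (\<alpha> - 1)))"
proof -
  interpret P: prob_space P by fact
  have F: "\<And>x y. x \<le> y \<Longrightarrow> F x \<le> F y" "\<And>x. continuous (at_right x) F" "(F \<longlongrightarrow> 0) at_bot" "(F \<longlongrightarrow> 1) at_top"
    using assms(5) by (auto simp: distribution_function_def mono_def)
  define D where "D = interval_measure F"
  interpret D: real_distribution D
    unfolding D_def by (rule real_distribution_interval_measure[OF F])
  have cdf_D: "cdf D = F"
    unfolding D_def by (rule cdf_interval_measure[OF F(1-3)])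
  have tail_eq: "tail F t = measure D {t<..}" for t
  proof -
    have "UNIV - {..t} = {t<..}" by auto
    then show ?thesis
      using D.prob_compl[of "{..t}"] by (simp add: tail_def cdf_def cdf_D [symmetric])
  qed
  have indep: "P.indep_vars (\<lambda>_. borel) X {1..}" and cdf_X: "\<And>n. n \<ge> 1 \<Longrightarrow> cdf (distr P borel (X n)) = F"
    using assms(11) by (auto simp: iid_with_cdf_def)
  have distr_X: "distr P borel (X n) = D" if "n \<ge> 1" for n
  proof (rule cdf_unique)
    have "X n \<in> borel_measurable P" using indep that by (auto simp: P.indep_vars_def)
    then show "real_distribution (distr P borel (X n))"
      by (intro real_distribution.intro P.prob_space_distr) (auto simp: real_distribution_axioms_def)
    show "real_distribution D" by unfold_locales
    show "cdf (distr P borel (X n)) = cdf D" using cdf_X[OF that] cdf_D by simp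
  qed
  interpret walk: iid_walk P D "tail F" \<alpha> X "taylor_coeff g" g_inf
  proof unfold_locales
    show "tail F y \<le> tail F x" if "x \<le> y" for x y using F(1)[OF that] by (simp add: tail_def)
    show "0 \<le> tail F x" for x by (simp add: tail_eq)
    show "integrable D (\<lambda>x. x)" using assms(6) by (simp add: has_finite_mean_def D_def)
    show "(LINT x|D. x) < 0" using assms(7) by (simp add: mean_def D_def)
  qed (use assms(2,3,4,8,9) tail_eq indep distr_X in auto)
  have S_eq: "walk.S n \<omega> = gF_process g X n \<omega>" for n \<omega>
    by (simp add: walk.S_def gF_process_def)
  \<comment> \<open>A supremum is strictly above \<open>t\<close> exactly when one of its terms is,
    even if the supremum is infinite.\<close>
  have exceeds_eq: "walk.exceeds t = {\<omega> \<in> space P. gF_max g X \<omega> > ereal t}" for t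
    by (simp add: walk.exceeds_def gF_max_def less_SUP_iff S_eq)
  have c_eq: "walk.c = - mean F * g_inf" by (subst walk.c_def) (simp add: mean_def D_def)
  define L where "L = walk.G powr \<alpha> / (walk.c * (\<alpha> - 1))"
  have L: "L > 0" using walk.G_pos walk.c_pos assms(9) by (simp add: L_def)
  have rhs: "(SUP i. taylor_coeff g i) powr \<alpha> / (- mean F * g_inf) * (t * tail F t / (\<alpha> - 1)) = L * (t * tail F t)" for t
    unfolding L_def c_eq walk.G_def by simp
  have "((\<lambda>t. measure P (walk.exceeds t) / (t * tail F t) / L) \<longlongrightarrow> L / L) at_top"
    using L by (intro tendsto_divide[OF _ tendsto_const] walk.prob_exceeds_asymp[folded L_def]) auto
  then have "((\<lambda>t. measure P (walk.exceeds t) / (L * (t * tail F t))) \<longlongrightarrow> 1) at_top"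
    using L by (simp add: mult.commute)
  then show ?thesis
    unfolding rhs exceeds_eq by (rule asymp_equivI')
qed

end
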